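(* Let $k\geq 1$ be an integer. For each prime $p\ge 3$ let $$E_k(x) = \sum_{i=1}^{p-1} \frac{x^i}{i!\, i^k}$$ be the truncated polyexponential. Then $$N_{p}(E_k) \ll_k \frac{p}{\sqrt{\log p}},$$ that is, there is a constant $C_k>0$ depending only on $k$ such that $N_p(E_k)\le C_k\, p/\sqrt{\log p}$ for all primes $p\geq 3$.
   Context: For a prime $p\ge 3$ and a polynomial $F(x)$ with rational coefficients whose denominators are coprime to $p$, $N_p(F)$ denotes the number of solutions $x$ modulo $p$ of the congruence $F(x)\equiv 0 \bmod p$ (i.e. the number of roots in $\mathbb{F}_p$ of the reduction of $F$ modulo $p$). The polynomial $E_k$ depends on $p$. *)

theory Defs
  imports Complex_Main "HOL-Computational_Algebra.Polynomial" "HOL-Computational_Algebra.Primes"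
begin

text \<open>
  Congruence of rational numbers modulo \<open>p\<close>, i.e. congruence modulo \<open>p\<close> times the ring of
  rationals whose denominators are coprime to \<open>p\<close>.  For \<open>p \<ge> 2\<close> coprimality forces
  \<open>v \<noteq> 0\<close>.
\<close>

definition rat_cong :: "nat \<Rightarrow> rat \<Rightarrow> rat \<Rightarrow> bool" where
  "rat_cong p a b \<longleftrightarrow>
     (\<exists>u v :: int. coprime v (int p) \<and> a - b = of_nat p * (of_int u / of_int v))"

text \<open>
  The number of residue classes \<open>x\<close> modulo \<open>p\<close> with \<open>F(x) \<equiv> 0\<close> modulo \<open>p\<close>, counted on the
  representatives \<open>0, \<dots>, p - 1\<close>.  It is meant for \<open>F\<close> whose coefficients have denominators
  coprime to \<open>p\<close>; then the choice of representatives is immaterial and this is the number of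
  roots of the reduction of \<open>F\<close> in the field with \<open>p\<close> elements.
\<close>

definition num_solutions_mod :: "nat \<Rightarrow> rat poly \<Rightarrow> nat" where
  "num_solutions_mod p F = card {x :: nat. x < p \<and> rat_cong p (poly F (of_nat x)) 0}"

definition truncated_polyexp :: "nat \<Rightarrow> nat \<Rightarrow> rat poly" where
  "truncated_polyexp p k = (\<Sum>i = 1..p - 1. monom (1 / (fact i * of_nat i ^ k)) i)"

end

theory Submission
  imports
    "HOL-Number_Theory.Residues"
    "HOL-Library.FuncSet"
    "HOL-Real_Asymp.Real_Asymp"
    Defs
begin

text \<open>
  The proof is Stepanov's method over \<open>\<int>/p\<close>. Let \<open>G\<^sub>0\<close> be the truncated exponential, \<open>G\<^sub>j\<close> the truncated
  polyexponential \<open>E\<^sub>j\<close> for \<open>j \<ge> 1\<close>, and \<open>\<theta> = x d/dx\<close>. Modulo \<open>p\<close> they satisfy the closed system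
  \<open>\<theta> G\<^sub>0 = x G\<^sub>0 + w\<close>, \<open>\<theta> G\<^sub>1 = G\<^sub>0 - 1\<close>, \<open>\<theta> G\<^sub>j = G\<^bsub>j-1\<^esub>\<close>, where \<open>w\<close> is a constant multiple of \<open>x\<^sup>p\<close>.

  Consider combinations of the functions \<open>x^(a + p b) G\<^sub>0^m\<^sub>0 \<cdots> G\<^sub>k^m\<^sub>k\<close> with \<open>a < N\<^sup>2\<close>, \<open>b < N\<close> and all
  \<open>m\<^sub>j < N\<close>. Their derivatives have the same shape. At a nonzero root of \<open>G\<^sub>k\<close> in \<open>\<int>/p\<close> one has \<open>x\<^sup>p = x\<close>, which
  merges \<open>a\<close> and \<open>b\<close>, and \<open>G\<^sub>k = 0\<close>, which removes one variable. Counting parameters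
  (\<open>aux_coefficients_exist\<close>), some combination with coefficients not all zero vanishes at all these roots
  to an order \<open>M\<close> of size \<open>N\<^sup>2\<close>. Its degree has size \<open>p N\<close>. If the combination is not the zero polynomial,
  there are thus at most \<open>O(p / N)\<close> roots (\<open>stepanov_inequality\<close>, with \<open>multiple_roots_mod_bound\<close>).

  What has to be excluded is an accidental relation between these functions. Splitting off the lowest
  power \<open>x^(p b)\<close>, it suffices that a nonzero polynomial in \<open>x, G\<^sub>0, \<dots>, G\<^sub>k\<close> of small degree never vanishes
  to order \<open>p\<close> at the origin (\<open>zero_estimate\<close>), a quantitative form modulo \<open>p\<close> of the algebraic
  independence of the polyexponentials. Give \<open>G\<^sub>j\<close> the weight \<open>j\<close>. In the highest weight that occurs, \<open>\<theta>\<close>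
  acts as on \<open>f(x) e\<^bsup>c x\<^esup>\<close> with polynomials \<open>f\<close>. Suitable operators \<open>\<theta> - i - c x\<close> annihilate this part after a
  controlled number of steps and leave something of lower weight, unless the whole expression has been
  annihilated. In that case the equations one weight below show that only \<open>a x\<^sup>i G\<^sub>0^c\<close> can be left
  (\<open>extremal_form_vanishes\<close>), which visibly does not vanish to order \<open>p\<close>.

  Each descent in weight multiplies degrees by a factor of order \<open>N\<close>, and the weights go up to
  \<open>O(N)\<close>. So the zero estimate needs \<open>p\<close> to exceed \<open>exp (O(N log N))\<close>, and \<open>N\<close> may be taken of the order of
  \<open>sqrt (ln p)\<close>.
\<close>

section \<open>The Euler derivation on integer polynomials\<close>

text \<open>
  With \<open>\<theta> = x d/dx\<close> the polyexponentials are linked by \<open>\<theta> G\<^sub>j = G\<^bsub>j-1\<^esub>\<close>, with no denominators; at a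
  nonzero point of \<open>\<int>/p\<close>, \<open>\<theta>\<close> detects multiplicities up to \<open>p\<close> just as \<open>d/dx\<close> does.
\<close>

definition euler_deriv :: "int poly \<Rightarrow> int poly" where
  "euler_deriv f = pCons 0 (pderiv f)"

lemma coeff_euler_deriv [simp]: "coeff (euler_deriv f) t = int t * coeff f t"
  by (cases t) (simp_all add: euler_deriv_def coeff_pderiv)

lemma euler_deriv_add: "euler_deriv (f + g) = euler_deriv f + euler_deriv g"
  by (simp add: poly_eq_iff algebra_simps)

lemma euler_deriv_diff: "euler_deriv (f - g) = euler_deriv f - euler_deriv g"
  by (simp add: poly_eq_iff algebra_simps)

lemma euler_deriv_0 [simp]: "euler_deriv 0 = 0"
  by (simp add: poly_eq_iff)

lemma euler_deriv_1 [simp]: "euler_deriv 1 = 0"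
  by (simp add: euler_deriv_def)

lemma euler_deriv_mult: "euler_deriv (f * g) = euler_deriv f * g + f * euler_deriv g"
proof -
  have e: "euler_deriv h = monom 1 1 * pderiv h" for h
    by (simp add: euler_deriv_def monom_altdef)
  show ?thesis
    by (simp only: e pderiv_mult) (simp add: algebra_simps)
qed

lemma euler_deriv_sum: "euler_deriv (sum f S) = (\<Sum>i\<in>S. euler_deriv (f i))"
  by (induction S rule: infinite_finite_induct) (simp_all add: euler_deriv_add)

lemma euler_deriv_power:
  "euler_deriv (f ^ n) = of_nat n * f ^ (n - 1) * euler_deriv f"
proof (induction n)
  case (Suc n)
  show ?case
    by (cases n) (use Suc in \<open>simp_all add: euler_deriv_mult algebra_simps\<close>)
qed simp

lemma euler_deriv_dvd: "[:c:] dvd f \<Longrightarrow> [:c:] dvd euler_deriv f"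
  by (simp add: const_poly_dvd_iff)

section \<open>Formal polynomials in the polyexponentials and their derivation\<close>

definition mons :: "nat \<Rightarrow> nat \<Rightarrow> (nat \<Rightarrow> nat) set" where
  "mons k d = {m. (\<forall>j>k. m j = 0) \<and> (\<Sum>j\<le>k. m j) \<le> d}"

text \<open>
  Differentiation replaces a factor \<open>G\<^sub>j\<close> by \<open>G\<^bsub>j-1\<^esub>\<close> and keeps a factor \<open>G\<^sub>0\<close>, up to lower order terms.
  Giving \<open>G\<^sub>j\<close> the weight \<open>j\<close> makes this triangular.
\<close>

definition mon_weight :: "nat \<Rightarrow> (nat \<Rightarrow> nat) \<Rightarrow> nat" where
  "mon_weight k m = (\<Sum>j\<le>k. j * m j)"

definition mon_eval :: "nat \<Rightarrow> (nat \<Rightarrow> int poly) \<Rightarrow> (nat \<Rightarrow> nat) \<Rightarrow> int poly" where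
  "mon_eval k G m = (\<Prod>j\<le>k. G j ^ m j)"

text \<open>
  A form stands for \<open>\<Sum>\<^sub>m F(m) G\<^sub>0^m\<^sub>0 \<cdots> G\<^sub>k^m\<^sub>k\<close>: to each exponent vector \<open>m\<close> it attaches a polynomial in
  \<open>x\<close>. The \<open>G\<^sub>j\<close> are kept apart from \<open>x\<close>, so that a form can be differentiated without being evaluated.
\<close>

type_synonym form = "(nat \<Rightarrow> nat) \<Rightarrow> int poly"

definition form_eval :: "nat \<Rightarrow> nat \<Rightarrow> (nat \<Rightarrow> int poly) \<Rightarrow> form \<Rightarrow> int poly" where
  "form_eval k d G F = (\<Sum>m\<in>mons k d. F m * mon_eval k G m)"

definition is_form :: "nat \<Rightarrow> nat \<Rightarrow> form \<Rightarrow> bool" where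
  "is_form k d F \<longleftrightarrow> (\<forall>m. m \<notin> mons k d \<longrightarrow> F m = 0)"

text \<open>
  The part of the derivation that comes from \<open>\<theta> G\<^sub>1 = G\<^sub>0 - 1\<close> and \<open>\<theta> G\<^sub>j = G\<^bsub>j-1\<^esub>\<close> for \<open>j \<ge> 2\<close>. The
  coefficient at \<open>m\<close> is collected from the exponent vectors that produce \<open>m\<close>, all of which have
  weight exactly one more than \<open>m\<close>.
\<close>

definition lowering :: "nat \<Rightarrow> form \<Rightarrow> form" where
  "lowering k F m =
     (\<Sum>j=1..k. if m (j - 1) = 0 then 0
        else of_nat (m j + 1) * F (m(j := m j + 1, j - 1 := m (j - 1) - 1)))
     - of_nat (m 1 + 1) * F (m(1 := m 1 + 1))"

text \<open>
  The lift of \<open>\<theta>\<close> to forms when \<open>\<theta> G\<^sub>0 = x G\<^sub>0 + w\<close>. For the exponential itself \<open>w = 0\<close>; for its truncation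
  \<open>w\<close> is a multiple of \<open>x\<^sup>p\<close>.
\<close>

definition form_deriv :: "nat \<Rightarrow> int poly \<Rightarrow> form \<Rightarrow> form" where
  "form_deriv k w F m = euler_deriv (F m) + of_nat (m 0) * (monom 1 1 * F m)
     + of_nat (m 0 + 1) * (w * F (m(0 := m 0 + 1))) + lowering k F m"

lemma sum_fun_upd:
  fixes m :: "nat \<Rightarrow> nat"
  shows "j \<le> k \<Longrightarrow> (\<Sum>i\<le>k. (m(j := v)) i) + m j = (\<Sum>i\<le>k. m i) + v"
  by (simp add: sum.remove[of "{..k}" j] cong: sum.cong_simp)

lemma weight_fun_upd:
  "j \<le> k \<Longrightarrow> mon_weight k (m(j := v)) + j * m j = mon_weight k m + j * v"
  unfolding mon_weight_def
  by (simp add: sum.remove[of "{..k}" j] cong: sum.cong_simp)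

lemma finite_bounded_funs:
  "finite {m :: nat \<Rightarrow> nat. (\<forall>j>k. m j = 0) \<and> (\<forall>j\<le>k. m j \<le> d)}"
proof -
  have "finite {m. \<forall>j. (j \<in> {..k} \<longrightarrow> m j \<in> {..d}) \<and> (j \<notin> {..k} \<longrightarrow> m j = 0)}"
    by (rule finite_set_of_finite_funs) auto
  then show ?thesis
    by (rule rev_finite_subset) (auto simp: not_le)
qed

lemma mons_le: "m \<in> mons k d \<Longrightarrow> m j \<le> d"
proof (cases "j \<le> k")
  case True
  assume "m \<in> mons k d"
  moreover have "m j \<le> (\<Sum>i\<le>k. m i)"
    by (rule member_le_sum) (use True in auto)
  ultimately show ?thesis by (auto simp: mons_def)
qed (auto simp: mons_def)

lemma finite_mons [simp]: "finite (mons k d)"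
  by (rule finite_subset[OF _ finite_bounded_funs[of k d]])
     (use mons_le in \<open>auto simp: mons_def\<close>)

lemma mons_move_iff:
  assumes "1 \<le> j" "j \<le> k" "m (j - 1) \<noteq> 0"
  shows "m(j := m j + 1, j - 1 := m (j - 1) - 1) \<in> mons k d \<longleftrightarrow> m \<in> mons k d"
proof -
  have "(\<Sum>i\<le>k. (m(j := m j + 1, j - 1 := m (j - 1) - 1)) i) = (\<Sum>i\<le>k. m i)"
    using sum_fun_upd[of "j-1" k "m(j := m j + 1)" "m (j-1) - 1"]
      sum_fun_upd[of j k m "m j + 1"] assms by (simp del: fun_upd_apply add: fun_upd_other)
  moreover have "(m(j := m j + 1, j - 1 := m (j - 1) - 1)) i = m i" if "i > k" for i
    using that assms by simp
  ultimately show ?thesis unfolding mons_def by (simp del: fun_upd_apply)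
qed

lemma mons_raise:
  assumes "m(j := m j + 1) \<in> mons k d"
  shows "m \<in> mons k d"
proof -
  let ?m = "m(j := m j + 1)"
  have z: "\<And>i. i > k \<Longrightarrow> ?m i = 0" and s: "(\<Sum>i\<le>k. ?m i) \<le> d"
    using assms unfolding mons_def by blast+
  have "m i \<le> ?m i" for i by simp
  then have "m i = 0" if "i > k" for i using z[OF that] by (metis le_zero_eq)
  moreover have "(\<Sum>i\<le>k. m i) \<le> (\<Sum>i\<le>k. ?m i)"
    by (rule sum_mono) simp
  ultimately show ?thesis using s unfolding mons_def by (simp del: fun_upd_apply)
qed

lemma mons_lower:
  assumes "m \<in> mons k d"
  shows "m(j := m j - 1) \<in> mons k d"
proof -
  have "(\<Sum>i\<le>k. (m(j := m j - 1)) i) \<le> (\<Sum>i\<le>k. m i)"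
    by (rule sum_mono) simp
  then show ?thesis using assms by (simp add: mons_def)
qed

lemma is_form_deriv:
  assumes "is_form k d F"
  shows "is_form k d (form_deriv k w F)"
  unfolding is_form_def
proof (intro allI impI)
  fix m assume m: "m \<notin> mons k d"
  have F: "F m' = 0" if "m' \<notin> mons k d" for m'
    using assms that by (simp add: is_form_def)
  have 1: "F (m(j := m j + 1)) = 0" for j
    using F mons_raise m by blast
  have 2: "F (m(j := m j + 1, j - 1 := m (j - 1) - 1)) = 0" if "j \<in> {1..k}" "m (j - 1) \<noteq> 0" for j
    using F mons_move_iff[of j k m d] that m by simp
  have "lowering k F m = 0"
    unfolding lowering_def 1 using 2 by (simp add: sum.neutral del: fun_upd_apply)
  then show "form_deriv k w F m = 0"
    unfolding form_deriv_def 1 F[OF m] by simp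
qed

lemma euler_deriv_prod_power:
  assumes "finite J"
  shows "euler_deriv (\<Prod>j\<in>J. G j ^ m j) =
    (\<Sum>j\<in>J. of_nat (m j) * (\<Prod>i\<in>J. G i ^ (m(j := m j - 1)) i) * euler_deriv (G j))"
  using assms
proof (induction J rule: finite_induct)
  case (insert a J)
  have 1: "(\<Prod>i\<in>J. G i ^ (m(a := m a - 1)) i) = (\<Prod>i\<in>J. G i ^ m i)"
    by (rule prod.cong) (use insert in auto)
  have 2: "(\<Prod>i\<in>insert a J. G i ^ (m(j := m j - 1)) i)
      = G a ^ m a * (\<Prod>i\<in>J. G i ^ (m(j := m j - 1)) i)" if "j \<in> J" for j
    using that insert by (subst prod.insert) auto
  have "euler_deriv (\<Prod>j\<in>insert a J. G j ^ m j)
      = of_nat (m a) * G a ^ (m a - 1) * euler_deriv (G a) * (\<Prod>j\<in>J. G j ^ m j)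
        + G a ^ m a * (\<Sum>j\<in>J. of_nat (m j) * (\<Prod>i\<in>J. G i ^ (m(j := m j - 1)) i) * euler_deriv (G j))"
    using insert by (simp add: euler_deriv_mult euler_deriv_power)
  also have "G a ^ m a * (\<Sum>j\<in>J. of_nat (m j) * (\<Prod>i\<in>J. G i ^ (m(j := m j - 1)) i) * euler_deriv (G j))
     = (\<Sum>j\<in>J. of_nat (m j) * (\<Prod>i\<in>insert a J. G i ^ (m(j := m j - 1)) i) * euler_deriv (G j))"
    unfolding sum_distrib_left by (rule sum.cong) (simp_all only: 2 mult_ac)
  also have "of_nat (m a) * G a ^ (m a - 1) * euler_deriv (G a) * (\<Prod>j\<in>J. G j ^ m j)
     = of_nat (m a) * (\<Prod>i\<in>insert a J. G i ^ (m(a := m a - 1)) i) * euler_deriv (G a)"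
    using insert 1 by (subst prod.insert) auto
  finally show ?case using insert by simp
qed simp

lemma mon_eval_upd:
  assumes "j \<le> k"
  shows "mon_eval k G (m(j := m j + 1)) = mon_eval k G m * G j"
proof -
  have "(\<Prod>i\<in>{..k} - {j}. G i ^ (m(j := m j + 1)) i) = (\<Prod>i\<in>{..k} - {j}. G i ^ m i)"
    by (rule prod.cong) auto
  then show ?thesis
    using assms unfolding mon_eval_def by (simp add: prod.remove[of "{..k}" j] del: fun_upd_apply) simp
qed

lemma mon_eval_lower:
  assumes "j \<le> k" "m j \<noteq> 0"
  shows "mon_eval k G (m(j := m j - 1)) * G j = mon_eval k G m"
  using mon_eval_upd[OF assms(1), of G "m(j := m j - 1)"] assms(2) by simp

lemma mons_move_back:
  assumes "1 \<le> j" "j \<le> k" "m \<in> mons k d" "m j \<noteq> 0"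
  shows "m(j := m j - 1, j - 1 := m (j - 1) + 1) \<in> mons k d"
proof -
  let ?m = "m(j := m j - 1, j - 1 := m (j - 1) + 1)"
  have "?m(j := ?m j + 1, j - 1 := ?m (j - 1) - 1) = m"
    using assms by auto
  then show ?thesis using mons_move_iff[of j k ?m d] assms by auto
qed

lemma sum_reindex_partial:
  fixes g :: "'a \<Rightarrow> 'c::comm_monoid_add" and h :: "'b \<Rightarrow> 'c"
  assumes "finite S" "finite T"
    and "\<And>a. a \<in> S \<Longrightarrow> P a \<Longrightarrow> j a \<in> T \<and> Q (j a) \<and> i (j a) = a \<and> h (j a) = g a"
    and "\<And>b. b \<in> T \<Longrightarrow> Q b \<Longrightarrow> i b \<in> S \<and> P (i b) \<and> j (i b) = b"
    and "\<And>a. a \<in> S \<Longrightarrow> \<not> P a \<Longrightarrow> g a = 0" "\<And>b. b \<in> T \<Longrightarrow> \<not> Q b \<Longrightarrow> h b = 0"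
  shows "sum g S = sum h T"
proof -
  have "sum g S = sum g {a\<in>S. P a}" "sum h T = sum h {b\<in>T. Q b}"
    using assms by (auto intro!: sum.mono_neutral_right)
  moreover have "sum g {a\<in>S. P a} = sum h {b\<in>T. Q b}"
    by (rule sum.reindex_bij_witness[of _ i j]) (use assms in auto)
  ultimately show ?thesis by simp
qed

lemma sum_reindex_lower:
  assumes F: "is_form k d F"
  shows "(\<Sum>m\<in>mons k d. of_nat (m j) * (F m * mon_eval k G (m(j := m j - 1))))
     = (\<Sum>m\<in>mons k d. of_nat (m j + 1) * (F (m(j := m j + 1)) * mon_eval k G m))"
proof (rule sum_reindex_partial[where P = "\<lambda>m. m j \<noteq> 0" and Q = "\<lambda>m. m(j := m j + 1) \<in> mons k d"
      and i = "\<lambda>m. m(j := m j + 1)" and j = "\<lambda>m. m(j := m j - 1)"])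
  show "m(j := m j - 1) \<in> mons k d \<and>
      (m(j := m j - 1))(j := (m(j := m j - 1)) j + 1) \<in> mons k d \<and>
      (m(j := m j - 1))(j := (m(j := m j - 1)) j + 1) = m \<and>
      of_nat ((m(j := m j - 1)) j + 1) * (F ((m(j := m j - 1))(j := (m(j := m j - 1)) j + 1))
      * mon_eval k G (m(j := m j - 1))) = of_nat (m j) * (F m * mon_eval k G (m(j := m j - 1)))"
    if "m \<in> mons k d" "m j \<noteq> 0" for m
  proof -
    have "(m(j := m j - 1)) j + 1 = m j" "(m(j := m j - 1))(j := m j) = m" using that by auto
    then show ?thesis using that mons_lower[of m k d j] by (simp only: refl simp_thms)
  qed
qed (use F in \<open>auto simp: is_form_def\<close>)

lemma sum_reindex_move:
  assumes F: "is_form k d F" and j: "1 \<le> j" "j \<le> k"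
  shows "(\<Sum>m\<in>mons k d. of_nat (m j) * (F m * mon_eval k G (m(j := m j - 1, j - 1 := m (j - 1) + 1))))
     = (\<Sum>m\<in>mons k d. (if m (j - 1) = 0 then 0
          else of_nat (m j + 1) * F (m(j := m j + 1, j - 1 := m (j - 1) - 1))) * mon_eval k G m)"
proof (rule sum_reindex_partial[where P = "\<lambda>m. m j \<noteq> 0" and Q = "\<lambda>m. m (j - 1) \<noteq> 0"
      and i = "\<lambda>m. m(j := m j + 1, j - 1 := m (j - 1) - 1)"
      and j = "\<lambda>m. m(j := m j - 1, j - 1 := m (j - 1) + 1)"])
  fix m
  assume m: "m \<in> mons k d" "m j \<noteq> 0"
  let ?m = "m(j := m j - 1, j - 1 := m (j - 1) + 1)"
  have "?m(j := ?m j + 1, j - 1 := ?m (j - 1) - 1) = m" "?m j + 1 = m j" "?m (j - 1) \<noteq> 0"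
    using m j by auto
  then show "?m \<in> mons k d \<and> ?m (j - 1) \<noteq> 0 \<and> ?m(j := ?m j + 1, j - 1 := ?m (j - 1) - 1) = m \<and>
      (if ?m (j - 1) = 0 then 0 else of_nat (?m j + 1) * F (?m(j := ?m j + 1, j - 1 := ?m (j - 1) - 1))) *
      mon_eval k G ?m = of_nat (m j) * (F m * mon_eval k G ?m)"
    using mons_move_back[OF j m] by (simp only: if_False mult.assoc simp_thms)
next
  fix m
  assume m: "m \<in> mons k d" "m (j - 1) \<noteq> 0"
  let ?m = "m(j := m j + 1, j - 1 := m (j - 1) - 1)"
  have "?m(j := ?m j - 1, j - 1 := ?m (j - 1) + 1) = m" "?m j \<noteq> 0"
    using m j by auto
  then show "?m \<in> mons k d \<and> ?m j \<noteq> 0 \<and> ?m(j := ?m j - 1, j - 1 := ?m (j - 1) + 1) = m"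
    using mons_move_iff[of j k m d] j m by (simp only: simp_thms)
qed auto

text \<open>
  The right-hand sides of the differential system for \<open>\<theta> G\<^sub>j\<close>.
\<close>

definition polyexp_rhs :: "int poly \<Rightarrow> (nat \<Rightarrow> int poly) \<Rightarrow> nat \<Rightarrow> int poly" where
  "polyexp_rhs w G j = (if j = 0 then monom 1 1 * G 0 + w else if j = 1 then G 0 - 1 else G (j - 1))"

text \<open>
  The product rule on monomials, after regrouping the sum by the exponent vector that each term
  lands on.
\<close>

lemma form_eval_form_deriv:
  assumes "k \<ge> 1" "is_form k d F" 
  shows "form_eval k d G (form_deriv k w F) = 
     (\<Sum>m\<in>mons k d. euler_deriv (F m) * mon_eval k G m) +
     (\<Sum>m\<in>mons k d. F m * (\<Sum>j\<le>k. of_nat (m j) * mon_eval k G (m(j := m j - 1)) * polyexp_rhs w G j))"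
proof -
  let ?E = "mon_eval k G"
  have key: "F m * (\<Sum>j\<le>k. of_nat (m j) * ?E (m(j := m j - 1)) * polyexp_rhs w G j)
     = of_nat (m 0) * (monom 1 1 * F m) * ?E m + of_nat (m 0) * (F m * ?E (m(0 := m 0 - 1))) * w
      + (\<Sum>j=1..k. of_nat (m j) * (F m * ?E (m(j := m j - 1, j - 1 := m (j - 1) + 1))))
      - of_nat (m 1) * (F m * ?E (m(1 := m 1 - 1)))" for m
  proof -
    have E0: "of_nat (m 0) * (?E (m(0 := m 0 - 1)) * G 0) = of_nat (m 0) * ?E m"
      using mon_eval_lower[of 0 k m G] by (cases "m 0 = 0") auto
    have mv: "?E (m(j := m j - 1, j - 1 := m (j - 1) + 1)) = ?E (m(j := m j - 1)) * G (j - 1)"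
      if "j \<in> {1..k}" for j
    proof -
      have "(m(j := m j - 1)) (j - 1) = m (j - 1)" "j - 1 \<le> k" using that by auto
      then show ?thesis using mon_eval_upd[of "j - 1" k G "m(j := m j - 1)"] by (simp only:)
    qed
    have S: "(\<Sum>j=1..k. of_nat (m j) * ?E (m(j := m j - 1)) * polyexp_rhs w G j)
       = (\<Sum>j=1..k. of_nat (m j) * ?E (m(j := m j - 1, j - 1 := m (j - 1) + 1))
           - (if j = 1 then of_nat (m 1) * ?E (m(1 := m 1 - 1)) else 0))"
    proof (rule sum.cong[OF refl])
      fix j assume "j \<in> {1..k}"
      then show "of_nat (m j) * ?E (m(j := m j - 1)) * polyexp_rhs w G j
        = of_nat (m j) * ?E (m(j := m j - 1, j - 1 := m (j - 1) + 1))
           - (if j = 1 then of_nat (m 1) * ?E (m(1 := m 1 - 1)) else 0)"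
        unfolding mv[OF \<open>j \<in> {1..k}\<close>]
        by (cases "j = 1") (simp_all add: polyexp_rhs_def right_diff_distrib mult.assoc)
    qed
    have "(\<Sum>j\<le>k. of_nat (m j) * ?E (m(j := m j - 1)) * polyexp_rhs w G j)
      = of_nat (m 0) * ?E (m(0 := m 0 - 1)) * polyexp_rhs w G 0
        + (\<Sum>j=1..k. of_nat (m j) * ?E (m(j := m j - 1)) * polyexp_rhs w G j)"
      by (simp add: atMost_atLeast0 sum.atLeast_Suc_atMost)
    also have "\<dots> = monom 1 1 * (of_nat (m 0) * (?E (m(0 := m 0 - 1)) * G 0))
        + of_nat (m 0) * ?E (m(0 := m 0 - 1)) * w
        + (\<Sum>j=1..k. of_nat (m j) * ?E (m(j := m j - 1, j - 1 := m (j - 1) + 1)))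
        - of_nat (m 1) * ?E (m(1 := m 1 - 1))"
      using assms(1) unfolding S
      by (simp add: sum_subtractf polyexp_rhs_def algebra_simps)
    finally have eq: "(\<Sum>j\<le>k. of_nat (m j) * ?E (m(j := m j - 1)) * polyexp_rhs w G j) = \<dots>" .
    show ?thesis
      unfolding eq E0 by (simp add: ring_distribs sum_distrib_left mult_ac del: fun_upd_apply)
  qed
  have A: "(\<Sum>m\<in>mons k d. F m * (\<Sum>j\<le>k. of_nat (m j) * ?E (m(j := m j - 1)) * polyexp_rhs w G j))
     = (\<Sum>m\<in>mons k d. of_nat (m 0) * (monom 1 1 * F m) * ?E m)
      + (\<Sum>m\<in>mons k d. of_nat (m 0) * (F m * ?E (m(0 := m 0 - 1)))) * w
      + (\<Sum>j=1..k. \<Sum>m\<in>mons k d. of_nat (m j) * (F m * ?E (m(j := m j - 1, j - 1 := m (j - 1) + 1))))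
      - (\<Sum>m\<in>mons k d. of_nat (m 1) * (F m * ?E (m(1 := m 1 - 1))))"
    unfolding key sum.distrib sum_subtractf sum_distrib_right by (subst sum.swap) (rule refl)
  have B: "(\<Sum>j=1..k. \<Sum>m\<in>mons k d. of_nat (m j) * (F m * ?E (m(j := m j - 1, j - 1 := m (j - 1) + 1))))
    = (\<Sum>j=1..k. \<Sum>m\<in>mons k d. (if m (j - 1) = 0 then 0
          else of_nat (m j + 1) * F (m(j := m j + 1, j - 1 := m (j - 1) - 1))) * ?E m)"
    by (rule sum.cong[OF refl], rule sum_reindex_move[OF assms(2)]) auto
  show ?thesis
    unfolding A B sum_reindex_lower[OF assms(2)] form_eval_def form_deriv_def lowering_def
    unfolding ring_distribs left_diff_distrib sum.distrib sum_subtractf sum_distrib_right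
    by (subst sum.swap) (simp only: mult_ac)
qed

text \<open>
  The differential system holds only as a congruence, and two moduli occur: \<open>p\<close>, for the polynomials
  themselves, and \<open>(p, x\<^sup>p)\<close>, for their behaviour at the origin. Both are treated at once as ideals.
\<close>

definition poly_ideal :: "int poly set \<Rightarrow> bool" where
  "poly_ideal I \<longleftrightarrow> 0 \<in> I \<and> (\<forall>f\<in>I. \<forall>g\<in>I. f + g \<in> I) \<and> (\<forall>f\<in>I. \<forall>h. h * f \<in> I)"

lemma poly_ideal_add: "poly_ideal I \<Longrightarrow> f \<in> I \<Longrightarrow> g \<in> I \<Longrightarrow> f + g \<in> I"
  by (simp add: poly_ideal_def)

lemma poly_ideal_mult: "poly_ideal I \<Longrightarrow> f \<in> I \<Longrightarrow> h * f \<in> I"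
  by (simp add: poly_ideal_def)

lemma poly_ideal_diff:
  assumes "poly_ideal I" "f \<in> I" "g \<in> I"
  shows "f - g \<in> I"
  using poly_ideal_add[OF assms(1,2) poly_ideal_mult[OF assms(1,3), of "-1"]] by simp

lemma poly_ideal_sum: "poly_ideal I \<Longrightarrow> (\<And>i. i \<in> S \<Longrightarrow> f i \<in> I) \<Longrightarrow> sum f S \<in> I"
  by (induction S rule: infinite_finite_induct) (auto simp: poly_ideal_def)

lemma form_eval_deriv:
  assumes "k \<ge> 1" "is_form k d F" "poly_ideal I"
    and "\<And>j. j \<le> k \<Longrightarrow> euler_deriv (G j) - polyexp_rhs w G j \<in> I"
  shows "euler_deriv (form_eval k d G F) - form_eval k d G (form_deriv k w F) \<in> I"
proof -
  let ?X = "\<lambda>m j. of_nat (m j) * mon_eval k G (m(j := m j - 1))"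
  have "euler_deriv (form_eval k d G F) = (\<Sum>m\<in>mons k d. euler_deriv (F m) * mon_eval k G m)
     + (\<Sum>m\<in>mons k d. F m * (\<Sum>j\<le>k. ?X m j * euler_deriv (G j)))"
    unfolding form_eval_def euler_deriv_sum euler_deriv_mult sum.distrib
    by (simp only: mon_eval_def euler_deriv_prod_power[OF finite_atMost])
  then have "euler_deriv (form_eval k d G F) - form_eval k d G (form_deriv k w F)
     = (\<Sum>m\<in>mons k d. F m * (\<Sum>j\<le>k. ?X m j * (euler_deriv (G j) - polyexp_rhs w G j)))"
    unfolding form_eval_form_deriv[OF assms(1,2)]
    by (simp only: right_diff_distrib sum_subtractf add_diff_cancel_left)
  also have "\<dots> \<in> I"
    by (intro poly_ideal_sum poly_ideal_mult assms) auto
  finally show ?thesis .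
qed

section \<open>The zero estimate at the origin\<close>

lemma weight_move:
  assumes "1 \<le> j" "j \<le> k" "m (j - 1) \<noteq> 0"
  shows "mon_weight k (m(j := m j + 1, j - 1 := m (j - 1) - 1)) = mon_weight k m + 1"
proof -
  have ne: "(m(j := m j + 1)) (j - 1) = m (j - 1)" using assms by simp
  obtain a where a: "m (j - 1) = Suc a" using assms(3) not0_implies_Suc by blast
  obtain j' where j': "j = Suc j'" using assms(1) by (cases j) auto
  have 1: "mon_weight k (m(j := m j + 1, j - 1 := a)) + (j - 1) * m (j - 1)
      = mon_weight k (m(j := m j + 1)) + (j - 1) * a"
    using weight_fun_upd[of "j - 1" k "m(j := m j + 1)" a] assms(2) unfolding ne by simp
  have 2: "mon_weight k (m(j := m j + 1)) + j * m j = mon_weight k m + j * (m j + 1)"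
    by (rule weight_fun_upd[OF assms(2)])
  have "m (j - 1) - 1 = a" using a by simp
  then show ?thesis using 1 2 unfolding a by (simp add: j' algebra_simps)
qed

lemma weight_raise:
  assumes "1 \<le> k"
  shows "mon_weight k (m(1 := m 1 + 1)) = mon_weight k m + 1"
  using weight_fun_upd[OF assms, of m "m 1 + 1"] by simp

lemma lowering_dvd:
  assumes "1 \<le> k" "\<And>m'. mon_weight k m' = mon_weight k m + 1 \<Longrightarrow> P dvd F m'"
  shows "P dvd lowering k F m"
  unfolding lowering_def
  by (intro dvd_diff dvd_sum)
     (auto intro!: dvd_mult assms(2) weight_move weight_raise assms(1)
       simp del: fun_upd_apply of_nat_add One_nat_def simp flip: One_nat_def)

text \<open>
  The operator \<open>\<theta> - i - c x\<close>. On coefficients of top weight, lowering contributes nothing, and there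
  it sends \<open>x\<^sup>i u G\<^sub>0^n\<close> to \<open>x\<^bsup>i+1\<^esup> (u' + (n - c) u) G\<^sub>0^n\<close>. Apart from the harmless power of \<open>x\<close> it is therefore
  \<open>d/dx - c\<close> acting on \<open>u e\<^bsup>n x\<^esup>\<close>: for \<open>n = c\<close> it lowers the degree of \<open>u\<close>, for \<open>n \<noteq> c\<close> it does not raise it.
\<close>

definition twisted_deriv :: "nat \<Rightarrow> nat \<Rightarrow> nat \<Rightarrow> form \<Rightarrow> form" where
  "twisted_deriv k i c F m =
     form_deriv k 0 F m - smult (int i) (F m) - smult (int c) (monom 1 1 * F m)"

lemma coeff_twisted_deriv:
  "coeff (twisted_deriv k i c F m) t = (int t - int i) * coeff (F m) t
     + (int (m 0) - int c) * (if t = 0 then 0 else coeff (F m) (t - 1)) + coeff (lowering k F m) t"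
proof -
  have 1: "coeff (of_nat n * f) t = int n * coeff f t" for n and f :: "int poly"
    by (simp add: of_nat_poly)
  have 2: "coeff (monom 1 1 * F m) t = (if t = 0 then 0 else coeff (F m) (t - 1))"
    by (cases t) (simp_all add: coeff_monom_mult)
  show ?thesis
    unfolding twisted_deriv_def form_deriv_def coeff_diff coeff_add coeff_smult 1 2 coeff_euler_deriv
    by (simp add: left_diff_distrib)
qed

lemma is_form_twisted:
  "is_form k d F \<Longrightarrow> is_form k d (twisted_deriv k i c F)"
  using is_form_deriv[of k d F 0] by (simp add: is_form_def twisted_deriv_def)

lemma form_eval_twisted:
  assumes "k \<ge> 1" "is_form k d F" "poly_ideal I" "\<And>f. f \<in> I \<Longrightarrow> euler_deriv f \<in> I"
    and "\<And>j. j \<le> k \<Longrightarrow> euler_deriv (G j) - polyexp_rhs 0 G j \<in> I"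
    and "form_eval k d G F \<in> I"
  shows "form_eval k d G (twisted_deriv k i c F) \<in> I"
proof -
  let ?E = "form_eval k d G"
  have "?E (twisted_deriv k i c F)
     = ?E (form_deriv k 0 F) - [:int i:] * ?E F - (smult (int c) (monom 1 1)) * ?E F"
    unfolding form_eval_def twisted_deriv_def
    by (simp add: sum_subtractf left_diff_distrib sum_distrib_left sum_distrib_left mult.assoc)
  also have "\<dots> \<in> I"
  proof -
    have "euler_deriv (?E F) - (euler_deriv (?E F) - ?E (form_deriv k 0 F)) \<in> I"
      by (rule poly_ideal_diff[OF assms(3) assms(4)[OF assms(6)] form_eval_deriv[OF assms(1,2,3,5)]])
    then have "?E (form_deriv k 0 F) \<in> I" by simp
    then show ?thesis
      using assms by (intro poly_ideal_diff poly_ideal_mult) auto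
  qed
  finally show ?thesis .
qed

lemma int_prime_dvd_mult_small:
  assumes "prime p" "int p dvd a * b" "a \<noteq> 0" "\<bar>a\<bar> < int p"
  shows "int p dvd b"
  using assms by (auto simp: prime_dvd_mult_iff dest: zdvd_imp_le dvd_imp_le_int)

text \<open>
  The ideal \<open>(p, x\<^sup>p)\<close>. Membership means vanishing to order \<open>p\<close> at the origin, modulo \<open>p\<close>.
\<close>

definition jet_ideal :: "nat \<Rightarrow> int poly set" where
  "jet_ideal p = {f. \<forall>t<p. int p dvd coeff f t}"

lemma poly_ideal_jet: "poly_ideal (jet_ideal p)"
  unfolding poly_ideal_def jet_ideal_def
  by (auto simp: coeff_mult intro!: dvd_sum dvd_mult)

lemma euler_deriv_jet: "f \<in> jet_ideal p \<Longrightarrow> euler_deriv f \<in> jet_ideal p"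
  by (simp add: jet_ideal_def)

text \<open>
  Polynomials \<open>G\<^sub>j\<close> that agree up to order \<open>p\<close> with a solution of the differential system, where \<open>G\<^sub>0\<close>
  plays the part of the exponential.
\<close>

locale jets =
  fixes p k d :: nat and G :: "nat \<Rightarrow> int poly"
  assumes p: "prime p" and k: "k \<ge> 1" and dp: "d < p"
    and G: "\<And>j. j \<le> k \<Longrightarrow> euler_deriv (G j) - polyexp_rhs 0 G j \<in> jet_ideal p"
    and G0: "coeff (G 0) 0 = 1"
begin

lemma dvd_small: "int p dvd a * b \<Longrightarrow> a \<noteq> 0 \<Longrightarrow> \<bar>a\<bar> < int p \<Longrightarrow> int p dvd b"
  using int_prime_dvd_mult_small[OF p] .

text \<open>
  A form annihilated by \<open>\<theta> - i - c x\<close> is too rigid to vanish at the origin. In top weight \<open>W\<close> the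
  equation \<open>x f' - i f + (m\<^sub>0 - c) x f = 0\<close> for a polynomial \<open>f\<close> of degree below \<open>p\<close> forces \<open>f = 0\<close> if
  \<open>m\<^sub>0 \<noteq> c\<close> and \<open>f = a x\<^sup>i\<close> if \<open>m\<^sub>0 = c\<close>. One weight lower the inhomogeneous equation
  \<open>x f' - i f + \<epsilon> x f = - b x\<^sup>i\<close> with \<open>\<epsilon> \<in> {0, 1}\<close> has a polynomial solution only if \<open>b = 0\<close>. This is the
  algebraic reason why the exponential integral (\<open>\<epsilon> = 1\<close>) and the logarithm (\<open>\<epsilon> = 0\<close>) are not rational
  over the preceding functions. Reading it for the variables \<open>G\<^sub>1, G\<^sub>2, \<dots>\<close> in turn shows that none of
  them occurs in top weight. Hence \<open>W = 0\<close>, the form is \<open>a x\<^sup>i G\<^sub>0^c\<close>, and its coefficient of \<open>x\<^sup>i\<close> is \<open>a\<close>.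
\<close>

lemma extremal_form_vanishes:
  assumes F: "is_form k d F" "form_eval k d G F \<in> jet_ideal p"
    and high: "\<And>m. mon_weight k m > W \<Longrightarrow> [:int p:] dvd F m"
    and deg: "\<And>m t. t > h \<Longrightarrow> int p dvd coeff (F m) t"
    and h: "h < p" and i: "i < p" and c: "c \<le> d"
    and tw: "\<And>m. [:int p:] dvd twisted_deriv k i c F m"
    and m: "mon_weight k m = W"
  shows "[:int p:] dvd F m"
proof -
  have low: "[:int p:] dvd lowering k F m" if "mon_weight k m = W" for m
    by (rule lowering_dvd[OF k]) (use high that in auto)
  have tw': "int p dvd (int t - int i) * coeff (F m) t
     + (int (m 0) - int c) * (if t = 0 then 0 else coeff (F m) (t - 1)) + coeff (lowering k F m) t" for m t
    using tw[of m] unfolding const_poly_dvd_iff coeff_twisted_deriv by blast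
  have eq: "int p dvd (int t - int i) * coeff (F m) t
     + (int (m 0) - int c) * (if t = 0 then 0 else coeff (F m) (t - 1))" if "mon_weight k m = W" for m t
    using tw'[of t m] low[OF that] by (simp add: const_poly_dvd_iff dvd_add_left_iff)
  have in_mons: "m \<in> mons k d" if "\<not> [:int p:] dvd F m" for m
    using F(1) that by (auto simp: is_form_def)
  have m0: "[:int p:] dvd F m" if m: "mon_weight k m = W" "m 0 \<noteq> c" for m
  proof (rule ccontr)
    assume "\<not> [:int p:] dvd F m"
    then have m0d: "m 0 \<le> d" using in_mons mons_le by blast
    have "int p dvd coeff (F m) t" if "t \<le> h + 1" for t
      using that
    proof (induction t rule: inc_induct)
      case base
      then show ?case using deg by simp
    next
      case (step t)
      have "int p dvd (int (m 0) - int c) * coeff (F m) t"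
        using eq[OF m(1), of "Suc t"] dvd_mult[OF step.IH, of "int (Suc t) - int i"]
        by (simp only: dvd_add_right_iff if_False nat.distinct diff_Suc_1)
      then show ?case
        by (rule dvd_small) (use m(2) m0d c dp in auto)
    qed
    then have "int p dvd coeff (F m) t" for t
      using deg[of t m] by (cases "t \<le> h") auto
    then show False using \<open>\<not> [:int p:] dvd F m\<close> by (simp add: const_poly_dvd_iff)
  qed
  have offi: "int p dvd coeff (F m) t" if "mon_weight k m = W" "t \<noteq> i" for m t
  proof (cases "m 0 = c \<and> t \<le> h")
    case True
    then have "int p dvd (int t - int i) * coeff (F m) t" using eq[OF that(1), of t] by simp
    then show ?thesis
      by (rule dvd_small) (use that(2) True h i in auto)
  next
    case False
    then show ?thesis using deg m0[OF that(1)] by (auto simp: const_poly_dvd_iff)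
  qed
  have suff: "[:int p:] dvd F m" if "mon_weight k m = W" "int p dvd coeff (F m) i" for m
    unfolding const_poly_dvd_iff using offi[OF that(1)] that(2) by metis
  have low1: "coeff (lowering k F m) t = 
      (\<Sum>l=1..k. if m (l - 1) = 0 then 0
        else int (m l + 1) * coeff (F (m(l := m l + 1, l - 1 := m (l - 1) - 1))) t)
     - int (m 1 + 1) * coeff (F (m(1 := m 1 + 1))) t" for m t
  proof -
    have "coeff (of_nat n * f) t = int n * coeff f t" for n and f :: "int poly"
      by (simp add: of_nat_poly)
    then show ?thesis
      unfolding lowering_def coeff_diff coeff_sum by (simp only: if_distrib[of "\<lambda>f. coeff f t"] coeff_0)
  qed
  have vars: "[:int p:] dvd F m" if "1 \<le> j" "j \<le> k" "mon_weight k m = W" "m j \<noteq> 0" for j m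
    using that
  proof (induction j arbitrary: m rule: less_induct)
    case (less j m)
    show ?case
    proof (rule ccontr)
      assume nd: "\<not> [:int p:] dvd F m"
      have mm: "m \<in> mons k d" using in_mons[OF nd] .
      have mc: "m 0 = c" using m0 less.prems nd by blast
      have mz: "m l = 0" if "1 \<le> l" "l < j" for l
        using less.IH[of l m] that less.prems nd by (metis le_trans less_imp_le)
      \<comment> \<open>The monomial of weight \<open>W - 1\<close> that \<open>m\<close> feeds when one factor \<open>G\<^sub>j\<close> is differentiated.\<close>
      define n where "n = m(j := m j - 1, j - 1 := m (j - 1) + 1)"
      have nj: "n (j - 1) \<noteq> 0" "n j + 1 = m j" "n(j := n j + 1, j - 1 := n (j - 1) - 1) = m"
        using less.prems by (auto simp: n_def)
      have wn: "mon_weight k n + 1 = W"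
        using weight_move[of j k n] less.prems nj by simp
      \<comment> \<open>Among the top-weight neighbours of \<open>n\<close>, only \<open>m\<close> survives: the others have exponent \<open>c + 1\<close> at
        \<open>G\<^sub>0\<close> when \<open>j = 1\<close>, and contain \<open>G\<^bsub>j-1\<^esub>\<close> otherwise.\<close>
      have oth: "[:int p:] dvd F (n(l := n l + 1, l - 1 := n (l - 1) - 1))"
        if l: "1 \<le> l" "l \<le> k" "n (l - 1) \<noteq> 0" "l \<noteq> j" for l
      proof -
        let ?n = "n(l := n l + 1, l - 1 := n (l - 1) - 1)"
        have wl: "mon_weight k ?n = W" using weight_move[of l k n, OF l(1-3)] wn by simp
        show ?thesis
        proof (cases "j = 1")
          case True
          then have "?n 0 = n 0" "n 0 = c + 1" using l mc by (auto simp: n_def)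
          then show ?thesis using m0[OF wl] by simp
        next
          case False
          have "?n (j - 1) \<noteq> 0" using nj(1) l(1,4) less.prems(1) by auto
          then show ?thesis using wl less.prems(1,2) False
            by (intro less.IH[of "j - 1"]) (simp_all del: fun_upd_apply)
        qed
      qed
      have last: "[:int p:] dvd F (n(1 := n 1 + 1))"
      proof -
        have wl: "mon_weight k (n(1 := n 1 + 1)) = W" using weight_raise[OF k] wn by simp
        show ?thesis
        proof (cases "j = 1")
          case True
          then have "(n(1 := n 1 + 1)) 0 = c + 1" using mc by (auto simp: n_def)
          then show ?thesis using m0[OF wl] by simp
        next
          case False
          have "(n(1 := n 1 + 1)) (j - 1) \<noteq> 0" using nj(1) by simp
          then show ?thesis using wl less.prems(1,2) False
            by (intro less.IH[of "j - 1"]) (simp_all del: fun_upd_apply)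
        qed
      qed
      have lown: "int p dvd coeff (lowering k F n) t - int (m j) * coeff (F m) t" for t
      proof -
        let ?g = "\<lambda>l. if n (l - 1) = 0 then 0
          else int (n l + 1) * coeff (F (n(l := n l + 1, l - 1 := n (l - 1) - 1))) t"
        have "?g j = int (m j) * coeff (F m) t" using nj by (simp only: if_False)
        then have "(\<Sum>l=1..k. ?g l) = int (m j) * coeff (F m) t + (\<Sum>l\<in>{1..k}-{j}. ?g l)"
          using less.prems by (subst sum.remove[of _ j]) auto
        moreover have "int p dvd (\<Sum>l\<in>{1..k}-{j}. ?g l)"
          using oth by (intro dvd_sum) (auto simp: const_poly_dvd_iff intro!: dvd_mult simp del: fun_upd_apply)
        moreover have "int p dvd int (n 1 + 1) * coeff (F (n(1 := n 1 + 1))) t"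
          using last by (simp add: const_poly_dvd_iff del: fun_upd_apply)
        ultimately show ?thesis unfolding low1 by (simp add: dvd_diff del: fun_upd_apply)
      qed
      have E: "int p dvd (int t - int i) * coeff (F n) t
          + (int (n 0) - int c) * (if t = 0 then 0 else coeff (F n) (t - 1)) + int (m j) * coeff (F m) t" for t
        using dvd_diff[OF tw'[of t n] lown[of t]] by (simp add: algebra_simps)
      have fin: "int p dvd int (m j) * coeff (F m) i"
      proof (cases "j = 1")
        case True
        have n0: "int (n 0) - int c = 1" using True mc by (simp add: n_def)
        \<comment> \<open>Here \<open>(t - i) f\<^sub>t + f\<^bsub>t-1\<^esub> = 0\<close> for \<open>t < i\<close>, so nothing is left to balance the term at \<open>t = i\<close>.\<close>
        have below: "int p dvd coeff (F n) t" if "t < i" for t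
          using that
        proof (induction t rule: less_induct)
          case (less t)
          have "int p dvd (if t = 0 then 0 else coeff (F n) (t - 1))" using less by auto
          moreover have "int p dvd int (m j) * coeff (F m) t"
            using offi[of m t] \<open>mon_weight k m = W\<close> less.prems by simp
          ultimately have "int p dvd (int t - int i) * coeff (F n) t"
            using E[of t] unfolding n0 by (metis dvd_add_left_iff mult_1)
          then show ?case
            by (rule dvd_small) (use less.prems i in auto)
        qed
        show ?thesis using E[of i] below[of "i - 1"] unfolding n0
          by (cases "i = 0") (simp_all add: dvd_add_right_iff)
      next
        case False
        then have "n 0 = c" using mc less.prems by (simp add: n_def)
        then show ?thesis using E[of i] by simp
      qed
      have "m j < p" using mons_le[OF mm, of j] dp by simp
      then have "int p dvd coeff (F m) i"
        using less.prems by (intro dvd_small[OF fin]) auto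
      then show False using suff less.prems nd by blast
    qed
  qed
  show ?thesis
  proof (rule ccontr)
    assume nd: "\<not> [:int p:] dvd F m"
    have mm: "m \<in> mons k d" using in_mons[OF nd] .
    have mc: "m 0 = c" using m0 m nd by blast
    have mz: "m j = 0" if "j \<noteq> 0" for j
      using vars[of j m] m nd mm that by (cases "j \<le> k") (auto simp: mons_def)
    have W: "W = 0" unfolding m[symmetric] mon_weight_def using mz by (metis (no_types, lifting) mult_eq_0_iff sum.neutral)
    have rest: "[:int p:] dvd F m'" if "m' \<noteq> m" for m'
    proof (rule ccontr)
      assume nd': "\<not> [:int p:] dvd F m'"
      then have w: "mon_weight k m' = W" using high[of m'] W by (cases "mon_weight k m' = 0") auto
      have "m' 0 = c" using m0 w nd' by blast
      moreover have "m' j = 0" if "j \<noteq> 0" for j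
        using vars[of j m'] w nd' in_mons[OF nd'] that by (cases "j \<le> k") (auto simp: mons_def)
      ultimately have "m' = m" using mc mz by (metis ext)
      then show False using that by simp
    qed
    have "int p dvd coeff (form_eval k d G F) i"
      using F(2) i by (simp add: jet_ideal_def)
    moreover have "form_eval k d G F = F m * mon_eval k G m
        + (\<Sum>m'\<in>mons k d - {m}. F m' * mon_eval k G m')"
      unfolding form_eval_def using mm by (simp add: sum.remove)
    moreover have "[:int p:] dvd (\<Sum>m'\<in>mons k d - {m}. F m' * mon_eval k G m')"
      using rest by (intro dvd_sum) auto
    ultimately have "int p dvd coeff (F m * mon_eval k G m) i"
      by (simp add: const_poly_dvd_iff dvd_add_left_iff)
    moreover have "coeff (F m * mon_eval k G m) i
        = coeff (F m) i * coeff (mon_eval k G m) 0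
          + (\<Sum>t\<in>{..i}-{i}. coeff (F m) t * coeff (mon_eval k G m) (i - t))"
      unfolding coeff_mult by (subst sum.remove[of _ i]) auto
    moreover have "int p dvd (\<Sum>t\<in>{..i}-{i}. coeff (F m) t * coeff (mon_eval k G m) (i - t))"
      using offi[OF m] by (intro dvd_sum) auto
    moreover have "coeff (mon_eval k G m) 0 = 1"
    proof -
      have "coeff (\<Prod>j\<in>J. G j ^ m j) 0 = (\<Prod>j\<in>J. coeff (G j) 0 ^ m j)" for J
        by (induction J rule: infinite_finite_induct) (auto simp: coeff_mult_0 coeff_0_power)
      then show ?thesis unfolding mon_eval_def using mz G0
        by (metis (no_types, lifting) power_0 power_one prod.neutral)
    qed
    ultimately have "int p dvd coeff (F m) i" by (simp add: dvd_add_left_iff)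
    then show False using suff m nd by blast
  qed
qed


text \<open>
  The operators \<open>\<theta> - i - c x\<close> for \<open>i = 0, 1, 2, \<dots>\<close>, where \<open>c\<close> moves on to the next value after every
  \<open>h + 1\<close> steps: enough to exhaust the degree of the coefficients at \<open>G\<^sub>0^c\<close>.
\<close>

fun twisted_orbit :: "nat \<Rightarrow> form \<Rightarrow> nat \<Rightarrow> form" where
  "twisted_orbit h F 0 = F"
| "twisted_orbit h F (Suc i) = twisted_deriv k i (i div (h + 1)) (twisted_orbit h F i)"

text \<open>
  After \<open>i\<close> steps a top-weight coefficient is \<open>x\<^sup>i u\<close>, where the degree bound of \<open>u\<close>, initially \<open>h\<close>, has
  dropped by the number of steps already spent on \<open>c = m\<^sub>0\<close>; the minimum in the last clause is this
  number.
\<close>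

lemma twisted_orbit_invariants:
  assumes F: "is_form k d F" "form_eval k d G F \<in> jet_ideal p"
    and high: "\<And>m. mon_weight k m > W \<Longrightarrow> [:int p:] dvd F m"
    and deg: "\<And>m t. t > h \<Longrightarrow> int p dvd coeff (F m) t"
  shows "is_form k d (twisted_orbit h F i)"
    and "form_eval k d G (twisted_orbit h F i) \<in> jet_ideal p"
    and "\<And>m. mon_weight k m > W \<Longrightarrow> [:int p:] dvd twisted_orbit h F i m"
    and "\<And>m t. t > h + i \<Longrightarrow> int p dvd coeff (twisted_orbit h F i m) t"
    and "\<And>m t. mon_weight k m = W \<Longrightarrow> t < i \<or> t + min (h + 1) (i - m 0 * (h + 1)) > h + i \<Longrightarrow>
           int p dvd coeff (twisted_orbit h F i m) t"
proof (induction i)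
  case 0
  { case 1 show ?case using F by simp }
  { case 2 show ?case using F by simp }
  { case 3 then show ?case using high by simp }
  { case 4 then show ?case using deg by simp }
  { case 5 then show ?case using deg by simp }
next
  case (Suc i)
  let ?H = "twisted_orbit h F i" and ?c = "i div (h + 1)"
  note [simp del] = fun_upd_apply
  have low: "[:int p:] dvd lowering k ?H m" if "mon_weight k m \<ge> W" for m
    by (rule lowering_dvd[OF k]) (use Suc.IH(3) that in auto)
  have degl: "int p dvd coeff (lowering k ?H m) t" if "t > h + i" for m t
  proof -
    have *: "int p dvd coeff (of_nat n * f) t" if "int p dvd coeff f t" for n and f :: "int poly"
      using that by (simp add: of_nat_poly)
    show ?thesis
      unfolding lowering_def coeff_diff coeff_sum
      by (intro dvd_diff dvd_sum)
         (use Suc.IH(4)[OF that] in \<open>auto intro!: * simp del: of_nat_add of_nat_Suc\<close>)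
  qed
  { case 1 show ?case using is_form_twisted[OF Suc.IH(1)] by simp }
  { case 2 show ?case
      using form_eval_twisted[OF k Suc.IH(1) poly_ideal_jet euler_deriv_jet G Suc.IH(2)] by simp }
  { case (3 m)
    have "int p dvd coeff (?H m) t" for t using Suc.IH(3)[OF 3] by (simp add: const_poly_dvd_iff)
    moreover have "int p dvd coeff (lowering k ?H m) t" for t
      using low[of m] 3 by (simp add: const_poly_dvd_iff)
    ultimately show ?case
      unfolding const_poly_dvd_iff twisted_orbit.simps coeff_twisted_deriv
      by (intro allI dvd_add dvd_mult) auto }
  { case (4 m t)
    have "int p dvd coeff (?H m) t" "int p dvd coeff (?H m) (t - 1)" "int p dvd coeff (lowering k ?H m) t"
      using Suc.IH(4) degl 4 by auto
    then show ?case
      unfolding twisted_orbit.simps coeff_twisted_deriv by (intro dvd_add dvd_mult) auto }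
  { case (5 m t)
    let ?n = "\<lambda>i. min (h + 1) (i - m 0 * (h + 1))"
    have l: "int p dvd coeff (lowering k ?H m) t"
      using low[of m] 5 by (simp add: const_poly_dvd_iff)
    have step: "?n (Suc i) = (if ?c = m 0 then ?n i + 1 else ?n i)"
    proof -
      have "?c * (h + 1) \<le> i" "i < ?c * (h + 1) + (h + 1)"
        using div_mult_mod_eq[of i "h + 1"] mod_less_divisor[of "h + 1" i] by linarith+
      moreover have "?c * (h + 1) + (h + 1) \<le> m 0 * (h + 1)" if "?c < m 0"
        using mult_le_mono1[of "Suc ?c" "m 0" "h + 1"] that by simp
      moreover have "m 0 * (h + 1) + (h + 1) \<le> ?c * (h + 1)" if "m 0 < ?c"
        using mult_le_mono1[of "Suc (m 0)" ?c "h + 1"] that by simp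
      ultimately show ?thesis by (cases ?c "m 0" rule: linorder_cases) auto
    qed
    have 1: "int p dvd (int t - int i) * coeff (?H m) t"
    proof (cases "t = i")
      case False
      then show ?thesis using 5 step by (intro dvd_mult Suc.IH(5)) (auto split: if_splits)
    qed simp
    have 2: "int p dvd (int (m 0) - int ?c) * (if t = 0 then 0 else coeff (?H m) (t - 1))"
    proof (cases "?c = m 0 \<or> t = 0")
      case False
      then have "int p dvd coeff (?H m) (t - 1)"
        using 5 step by (intro Suc.IH(5)) auto
      then show ?thesis by simp
    qed auto
    show ?case
      unfolding twisted_orbit.simps coeff_twisted_deriv using 1 2 l by (intro dvd_add) }
qed

text \<open>
  A nonzero form of small height cannot vanish to order \<open>p\<close> at the origin. Along the orbit of twisted
  derivatives the top weight dies out after \<open>(h + 1) (d + 1)\<close> steps. Just before it dies, either the next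
  derivative vanishes altogether, which \<open>extremal_form_vanishes\<close> excludes, or it is a nonzero form of
  lower weight and height below \<open>(h + 1) (d + 2)\<close>, and one descends. There are \<open>W + 1\<close> weights, which
  explains the bound.
\<close>

theorem zero_estimate:
  assumes "is_form k d F" "form_eval k d G F \<in> jet_ideal p"
    and "\<And>m. mon_weight k m > W \<Longrightarrow> [:int p:] dvd F m"
    and "\<And>m t. t > h \<Longrightarrow> int p dvd coeff (F m) t"
    and "(h + 1) * (d + 2) ^ (W + 1) \<le> p"
  shows "[:int p:] dvd F m"
  using assms
proof (induction W arbitrary: F h m rule: less_induct)
  case (less W F h m)
  have inv: "is_form k d (twisted_orbit h F i)" "form_eval k d G (twisted_orbit h F i) \<in> jet_ideal p"
      "mon_weight k m > W \<Longrightarrow> [:int p:] dvd twisted_orbit h F i m"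
      "t > h + i \<Longrightarrow> int p dvd coeff (twisted_orbit h F i m) t"
      "mon_weight k m = W \<Longrightarrow> t < i \<or> t + min (h + 1) (i - m 0 * (h + 1)) > h + i \<Longrightarrow>
           int p dvd coeff (twisted_orbit h F i m) t" for i m t
    using twisted_orbit_invariants[where F = F and W = W and h = h and i = i] less.prems(1-4) by blast+
  define top0 where "top0 i \<longleftrightarrow> (\<forall>m. mon_weight k m = W \<longrightarrow> [:int p:] dvd twisted_orbit h F i m)" for i
  have bound: "(h + 1) * (d + 2) \<le> p"
  proof -
    have "(h + 1) * (d + 2) * 1 \<le> (h + 1) * (d + 2) * (d + 2) ^ W"
      by (intro mult_le_mono2) simp
    also have "\<dots> = (h + 1) * (d + 2) ^ (W + 1)" by (simp only: power_add power_one_right mult_ac)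
    finally show ?thesis using less.prems(5) by simp
  qed
  have descend: "[:int p:] dvd F' m"
    if "is_form k d F'" "form_eval k d G F' \<in> jet_ideal p"
      "\<And>m. mon_weight k m \<ge> W \<Longrightarrow> [:int p:] dvd F' m"
      "\<And>m t. t > h' \<Longrightarrow> int p dvd coeff (F' m) t" "h' + 1 \<le> (h + 1) * (d + 2)" for F' h' m
  proof (cases W)
    case 0
    then show ?thesis using that(3) by simp
  next
    case (Suc V)
    have "(h' + 1) * (d + 2) ^ (V + 1) \<le> (h + 1) * (d + 2) * (d + 2) ^ (V + 1)"
      by (rule mult_le_mono1[OF that(5)])
    also have "\<dots> = (h + 1) * (d + 2) ^ (W + 1)"
      by (simp only: Suc add_Suc power_Suc mult_ac)
    also note less.prems(5)
    finally show ?thesis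
      using less.IH[of V F' h' m] that Suc by auto
  qed
  have "top0 ((h + 1) * (d + 1))"
    unfolding top0_def const_poly_dvd_iff
  proof (intro allI impI)
    fix m t assume m: "mon_weight k m = W"
    let ?L = "(h + 1) * (d + 1)"
    show "int p dvd coeff (twisted_orbit h F ?L m) t"
    proof (cases "m \<in> mons k d")
      case True
      then have "m 0 \<le> d" by (rule mons_le)
      then have "m 0 * (h + 1) \<le> d * (h + 1)" by (rule mult_le_mono1)
      then have "min (h + 1) (?L - m 0 * (h + 1)) = h + 1" by (simp add: algebra_simps)
      then show ?thesis using inv(5)[OF m, of t ?L] by (cases "t < ?L") auto
    next
      case False
      then show ?thesis using inv(1)[of ?L] by (simp add: is_form_def)
    qed
  qed
  moreover have "top0 0"
  proof (rule ccontr)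
    assume "\<not> top0 0"
    then obtain i where i: "\<not> top0 i" "top0 (Suc i)" "i < (h + 1) * (d + 1)"
      using \<open>top0 ((h + 1) * (d + 1))\<close> ex_least_nat_less[of top0 "(h + 1) * (d + 1)"] by blast
    let ?H = "twisted_orbit h F i" and ?c = "i div (h + 1)"
    have hi: "h + Suc i + 1 \<le> (h + 1) * (d + 2)" using i(3) by simp
    have "[:int p:] dvd twisted_orbit h F (Suc i) m" for m
      by (rule descend[OF inv(1,2) _ inv(4) hi])
         (use i(2) inv(3)[of _ "Suc i"] in \<open>auto simp: top0_def le_less simp del: twisted_orbit.simps\<close>)
    then have tw: "[:int p:] dvd twisted_deriv k i ?c ?H m" for m by simp
    have c: "?c \<le> d"
      using i(3) by (metis Suc_eq_plus1 less_Suc_eq_le less_mult_imp_div_less mult.commute)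
    have "[:int p:] dvd ?H m" if "mon_weight k m = W" for m
      by (rule extremal_form_vanishes[OF inv(1,2) inv(3) inv(4) _ _ c tw that])
         (use hi bound in auto)
    then show False using i(1) by (simp add: top0_def)
  qed
  ultimately have top: "[:int p:] dvd F m" if "mon_weight k m = W" for m
    using that by (simp add: top0_def)
  show ?case
    by (rule descend[OF less.prems(1,2) _ less.prems(4)])
       (use top less.prems(3) in \<open>auto simp: le_less\<close>)
qed

end

section \<open>Counting roots with multiplicity modulo a prime\<close>

lemma prime_const_poly: "prime p \<Longrightarrow> prime_elem [:int p:]"
  by (simp add: prime_elem_const_poly_iff)

lemma poly_dvd_const: "[:c:] dvd f \<Longrightarrow> c dvd poly f (a :: int)"
  by (auto elim!: dvdE)

lemma funpow_euler_deriv_dvd: "[:c:] dvd f \<Longrightarrow> [:c:] dvd (euler_deriv ^^ n) f"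
  by (induction n) (auto intro: euler_deriv_dvd)

lemma funpow_euler_deriv_diff: "(euler_deriv ^^ n) (f - g) = (euler_deriv ^^ n) f - (euler_deriv ^^ n) g"
  by (induction n) (simp_all add: euler_deriv_diff)

text \<open>
  At a root of order at least \<open>n\<close>, the \<open>n\<close>-th derivative reads off the next Taylor coefficient; the
  factor \<open>n! a^n\<close> is a unit modulo \<open>p\<close> as long as \<open>n < p\<close> and \<open>p\<close> does not divide \<open>a\<close>.
\<close>

lemma poly_funpow_euler_deriv:
  "poly ((euler_deriv ^^ n) ([:- a, 1:] ^ n * g)) a = fact n * a ^ n * poly g a"
proof (induction n arbitrary: g)
  case (Suc n)
  have x: "euler_deriv [:- a, 1:] = monom 1 1"
    by (simp add: euler_deriv_def monom_altdef pderiv_pCons)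
  have "euler_deriv ([:- a, 1:] ^ Suc n * g)
      = [:- a, 1:] ^ n * (of_nat (Suc n) * (monom 1 1 * g) + [:- a, 1:] * euler_deriv g)"
    unfolding euler_deriv_mult euler_deriv_power x by (simp add: algebra_simps del: of_nat_Suc)
  then have "(euler_deriv ^^ Suc n) ([:- a, 1:] ^ Suc n * g)
      = (euler_deriv ^^ n) ([:- a, 1:] ^ n * (of_nat (Suc n) * (monom 1 1 * g) + [:- a, 1:] * euler_deriv g))"
    by (simp only: funpow_Suc_right o_apply)
  then show ?case
    using Suc[of "of_nat (Suc n) * (monom 1 1 * g) + [:- a, 1:] * euler_deriv g"]
    by (simp add: poly_monom algebra_simps)
qed simp

lemma synthetic_div_mod:
  assumes "c dvd poly g (a :: int)"
  shows "[:c:] dvd g - [:- a, 1:] * synthetic_div g a"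
proof -
  have "g - [:- a, 1:] * synthetic_div g a = [:poly g a:]"
    using synthetic_div_correct'[of a g] by (simp add: algebra_simps)
  then show ?thesis using assms by simp
qed

lemma multiple_root_factor:
  assumes p: "prime p" and a: "\<not> int p dvd a"
    and "M \<le> p" "\<And>n. n < M \<Longrightarrow> int p dvd poly ((euler_deriv ^^ n) f) a"
  shows "\<exists>g. [:int p:] dvd f - [:- a, 1:] ^ M * g"
  using assms(3,4)
proof (induction M)
  case 0
  show ?case by (rule exI[of _ f]) simp
next
  case (Suc M)
  then obtain g where g: "[:int p:] dvd f - [:- a, 1:] ^ M * g" by auto
  have "int p dvd poly ((euler_deriv ^^ M) f) a - poly ((euler_deriv ^^ M) ([:- a, 1:] ^ M * g)) a"
    using poly_dvd_const[OF funpow_euler_deriv_dvd[OF g, of M], of a] by (simp add: funpow_euler_deriv_diff)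
  then have "int p dvd poly ((euler_deriv ^^ M) f) a - fact M * a ^ M * poly g a"
    by (simp only: poly_funpow_euler_deriv)
  moreover have "int p dvd poly ((euler_deriv ^^ M) f) a" using Suc.prems by simp
  ultimately have "int p dvd fact M * a ^ M * poly g a" by (metis dvd_diff_right_iff)
  moreover have "\<not> int p dvd fact M"
    using p Suc.prems(1) by (metis Suc_le_lessD int_dvd_int_iff not_le of_nat_fact prime_dvd_fact_iff)
  moreover have "\<not> int p dvd a ^ M"
    using p a by (meson prime_dvd_power prime_nat_int_transfer)
  ultimately have "int p dvd poly g a"
    using p by (simp add: prime_dvd_mult_iff)
  then have "[:int p:] dvd (f - [:- a, 1:] ^ M * g) + [:- a, 1:] ^ M * (g - [:- a, 1:] * synthetic_div g a)"
    using g synthetic_div_mod by (intro dvd_add dvd_mult) auto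
  then show ?case
    by (intro exI[of _ "synthetic_div g a"]) (simp add: algebra_simps)
qed

lemma coprime_cofactor:
  assumes p: "prime p" and R: "\<not> int p dvd poly R a"
    and "[:int p:] dvd R * g - [:- a, 1:] ^ M * h"
  shows "\<exists>g'. [:int p:] dvd g - [:- a, 1:] ^ M * g'"
  using assms(3)
proof (induction M arbitrary: g)
  case 0
  show ?case by (rule exI[of _ g]) simp
next
  case (Suc M)
  have "int p dvd poly R a * poly g a"
    using poly_dvd_const[OF Suc.prems, of a] by simp
  then have "int p dvd poly g a" using R p by (simp add: prime_dvd_mult_iff)
  note g = synthetic_div_mod[OF this]
  let ?g = "synthetic_div g a"
  have "[:int p:] dvd (R * g - [:- a, 1:] ^ Suc M * h) - R * (g - [:- a, 1:] * ?g)"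
    by (rule dvd_diff[OF Suc.prems dvd_mult[OF g]])
  then have "[:int p:] dvd [:- a, 1:] * (R * ?g - [:- a, 1:] ^ M * h)"
    by (simp add: algebra_simps)
  moreover have "\<not> [:int p:] dvd [:- a, 1:]"
  proof
    assume "[:int p:] dvd [:- a, 1:]"
    then have "int p dvd coeff [:- a, 1:] 1" unfolding const_poly_dvd_iff by blast
    then show False using prime_gt_1_nat[OF p] by simp
  qed
  ultimately have "[:int p:] dvd R * ?g - [:- a, 1:] ^ M * h"
    using prime_elem_dvd_mult_iff[OF prime_const_poly[OF p]] by blast
  then obtain g' where "[:int p:] dvd ?g - [:- a, 1:] ^ M * g'" using Suc.IH by blast
  then have "[:int p:] dvd (g - [:- a, 1:] * ?g) + [:- a, 1:] * (?g - [:- a, 1:] ^ M * g')"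
    using g by (intro dvd_add dvd_mult)
  moreover have "g - X * q + X * (q - Y * h') = g - X * Y * h'" for X Y q h' :: "int poly"
    by (simp add: algebra_simps)
  ultimately show ?case by (metis power_Suc)
qed

text \<open>
  Modulo \<open>p\<close>, the leading term of \<open>R\<close> times the last nonzero term of \<open>g\<close> survives in the product.
\<close>

lemma degree_le_of_monic_factor_mod:
  assumes f: "\<not> [:int p:] dvd f" and fR: "[:int p:] dvd f - R * g" and R: "lead_coeff R = 1"
  shows "degree R \<le> degree f"
proof -
  have ng: "\<not> [:int p:] dvd g"
  proof
    assume "[:int p:] dvd g"
    then have "[:int p:] dvd (f - R * g) + R * g" using fR by (intro dvd_add dvd_mult)
    then show False using f by simp
  qed
  define T where "T = {t. \<not> int p dvd coeff g t}"
  have "T \<subseteq> {..degree g}"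
    unfolding T_def by (auto intro!: le_degree)
  then have fin: "finite T" by (rule finite_subset) simp
  have ne: "T \<noteq> {}" using ng unfolding T_def const_poly_dvd_iff by blast
  define t where "t = Max T"
  have t: "\<not> int p dvd coeff g t" using Max_in[OF fin ne] by (simp add: T_def t_def)
  have above: "int p dvd coeff g s" if "s > t" for s
    using Max_ge[OF fin, of s] that by (auto simp: T_def t_def)
  let ?n = "degree R + t"
  have "coeff (R * g) ?n = coeff R (degree R) * coeff g t
      + (\<Sum>i\<in>{..?n} - {degree R}. coeff R i * coeff g (?n - i))"
    unfolding coeff_mult by (subst sum.remove[of _ "degree R"]) auto
  moreover have "int p dvd (\<Sum>i\<in>{..?n} - {degree R}. coeff R i * coeff g (?n - i))"
  proof (intro dvd_sum)
    fix i assume "i \<in> {..?n} - {degree R}"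
    then consider "i < degree R" | "i > degree R" by force
    then show "int p dvd coeff R i * coeff g (?n - i)"
      by cases (auto intro!: dvd_mult above simp: coeff_eq_0)
  qed
  ultimately have "\<not> int p dvd coeff (R * g) ?n"
    using t R by (simp add: dvd_add_left_iff)
  moreover have "int p dvd coeff f ?n - coeff (R * g) ?n"
    using fR unfolding const_poly_dvd_iff coeff_diff by blast
  ultimately have "coeff f ?n \<noteq> 0" by auto
  then have "?n \<le> degree f" by (rule le_degree)
  then show ?thesis by simp
qed

text \<open>
  A polynomial over a field has at most as many roots, with multiplicity, as its degree; here the
  field is \<open>\<int>/p\<close>, the polynomial has integer coefficients, and multiplicity is expressed through \<open>\<theta>\<close>.
\<close>

theorem multiple_roots_mod_bound:
  assumes p: "prime p" and "M \<le> p" and S: "S \<subseteq> {1..<int p}"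
    and f: "\<not> [:int p:] dvd f"
    and "\<And>a n. a \<in> S \<Longrightarrow> n < M \<Longrightarrow> int p dvd poly ((euler_deriv ^^ n) f) a"
  shows "M * card S \<le> degree f"
proof -
  have "finite S" using S finite_subset by blast
  then have "S \<subseteq> {1..<int p} \<Longrightarrow> (\<And>a n. a \<in> S \<Longrightarrow> n < M \<Longrightarrow> int p dvd poly ((euler_deriv ^^ n) f) a)
     \<Longrightarrow> \<exists>g. [:int p:] dvd f - (\<Prod>a\<in>S. [:- a, 1:] ^ M) * g"
  proof (induction S rule: finite_induct)
    case empty
    show ?case by (rule exI[of _ f]) simp
  next
    case (insert a S)
    obtain g where g: "[:int p:] dvd f - (\<Prod>a\<in>S. [:- a, 1:] ^ M) * g"
      using insert by blast
    have "\<not> int p dvd a" using insert.prems(1) by (auto dest: zdvd_imp_le)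
    then obtain h where h: "[:int p:] dvd f - [:- a, 1:] ^ M * h"
      using multiple_root_factor[OF p _ \<open>M \<le> p\<close>] insert.prems(2) by blast
    have "\<not> int p dvd poly (\<Prod>a\<in>S. [:- a, 1:] ^ M) a"
    proof
      assume "int p dvd poly (\<Prod>a\<in>S. [:- a, 1:] ^ M) a"
      then have "int p dvd (\<Prod>b\<in>S. (a - b) ^ M)" by (simp add: poly_prod)
      then obtain b where b: "b \<in> S" "int p dvd (a - b) ^ M"
        using p insert.hyps(1) by (auto simp: prime_dvd_prod_iff)
      then have "int p dvd a - b" using p by (meson prime_dvd_power prime_nat_int_transfer)
      moreover have "b \<in> {1..<int p}" "a \<in> {1..<int p}"
        using b(1) insert.prems(1) by blast+
      moreover have "a \<noteq> b" using b(1) insert.hyps(2) by blast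
      ultimately show False using dvd_imp_le_int[of "a - b" "int p"] by (auto simp: abs_if split: if_splits)
    qed
    moreover have "[:int p:] dvd (\<Prod>a\<in>S. [:- a, 1:] ^ M) * g - [:- a, 1:] ^ M * h"
      using dvd_diff[OF h g] by (simp add: algebra_simps)
    ultimately obtain g' where g': "[:int p:] dvd g - [:- a, 1:] ^ M * g'"
      using coprime_cofactor[OF p] by blast
    have "[:int p:] dvd (f - (\<Prod>a\<in>S. [:- a, 1:] ^ M) * g)
        + (\<Prod>a\<in>S. [:- a, 1:] ^ M) * (g - [:- a, 1:] ^ M * g')"
      using g g' by (intro dvd_add dvd_mult)
    then show ?case
      using insert.hyps by (intro exI[of _ g']) (simp add: algebra_simps)
  qed
  then obtain g where g: "[:int p:] dvd f - (\<Prod>a\<in>S. [:- a, 1:] ^ M) * g"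
    using assms by blast
  have "lead_coeff (\<Prod>a\<in>S. [:- a, 1:] ^ M) = 1"
    by (simp add: lead_coeff_prod lead_coeff_power)
  moreover have "degree (\<Prod>a\<in>S. [:- a, 1:] ^ M) = M * card S"
    by (subst degree_prod_eq_sum_degree) (simp_all add: degree_power_eq mult.commute)
  ultimately show ?thesis
    using degree_le_of_monic_factor_mod[OF f g] by simp
qed

section \<open>The truncated polyexponentials modulo a prime\<close>

text \<open>
  An integer model of \<open>\<Sum> x\<^sup>i / (i! i\<^sup>j)\<close> modulo \<open>p\<close>, in which the \<open>(p - 2)\<close>-th power plays the part of the
  inverse. For \<open>p \<ge> 3\<close>, the coefficient at \<open>i = 0\<close> is \<open>1\<close> for \<open>j = 0\<close> and \<open>0\<close> for \<open>j > 0\<close>, so \<open>G\<^sub>0\<close> is the full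
  truncated exponential and \<open>G\<^sub>1, G\<^sub>2, \<dots>\<close> have no constant term.
\<close>

definition polyexp_mod :: "nat \<Rightarrow> nat \<Rightarrow> int poly" where
  "polyexp_mod p j = (\<Sum>i<p. monom ((fact i * int i ^ j) ^ (p - 2)) i)"

lemma coeff_polyexp_mod:
  "coeff (polyexp_mod p j) t = (if t < p then (fact t * int t ^ j) ^ (p - 2) else 0)"
  by (simp add: polyexp_mod_def coeff_sum if_distrib cong: if_cong)

lemma degree_polyexp_mod: "p > 0 \<Longrightarrow> degree (polyexp_mod p j) < p"
  by (rule degree_lessI) (auto simp: coeff_polyexp_mod)

lemma fermat_int:
  assumes "prime p" "\<not> int p dvd a"
  shows "int p dvd a ^ (p - 1) - 1"
proof -
  define b where "b = nat (a mod int p)"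
  have b: "int b = a mod int p"
    using prime_gt_0_nat[OF assms(1)] by (simp add: b_def)
  then have ab: "[a = int b] (mod int p)" by (simp add: cong_def)
  have "\<not> p dvd b"
    using assms(2) cong_dvd_iff[OF ab] by simp
  then have "[b ^ (p - 1) = 1] (mod p)" by (rule fermat_theorem[OF assms(1)])
  then have "[int (b ^ (p - 1)) = int 1] (mod int p)" by (simp only: cong_int_iff)
  then have "[int b ^ (p - 1) = 1] (mod int p)" by simp
  then have "[a ^ (p - 1) = 1] (mod int p)" by (rule cong_trans[OF cong_pow[OF ab]])
  then show ?thesis by (simp add: cong_iff_dvd_diff)
qed

lemma fermat_inverse:
  assumes "prime p" "p \<ge> 3" "\<not> int p dvd a"
  shows "int p dvd a * a ^ (p - 2) - 1"
proof -
  have "a * a ^ (p - 2) = a ^ (p - 1)"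
  proof -
    have "p - 1 = Suc (p - 2)" using assms(2) by simp
    then show ?thesis by simp
  qed
  then show ?thesis using fermat_int[OF assms(1,3)] by simp
qed

lemma fermat_inverse_mult:
  assumes "prime p" "p \<ge> 3" "\<not> int p dvd a"
  shows "int p dvd a * (b * a) ^ (p - 2) - b ^ (p - 2)"
proof -
  have "a * (b * a) ^ (p - 2) - b ^ (p - 2) = b ^ (p - 2) * (a * a ^ (p - 2) - 1)"
    by (simp add: power_mult_distrib algebra_simps)
  then show ?thesis using fermat_inverse[OF assms] by simp
qed

text \<open>
  The truncation error in \<open>\<theta> G\<^sub>0 = x G\<^sub>0 + w\<close>: the top term of \<open>x G\<^sub>0\<close>, with the opposite sign.
\<close>

definition top_term :: "nat \<Rightarrow> int poly" where
  "top_term p = monom (- ((fact (p - 1)) ^ (p - 2))) p"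

lemma polyexp_mod_rhs:
  assumes p: "prime p" "p \<ge> 3"
  shows "[:int p:] dvd euler_deriv (polyexp_mod p j) - polyexp_rhs (top_term p) (polyexp_mod p) j"
  unfolding const_poly_dvd_iff
proof
  fix t
  have nd: "\<not> int p dvd int t" if "0 < t" "t < p" for t
    using that by (auto dest: dvd_imp_le)
  have z: "0 ^ (p - 2) = (0 :: int)" using p by simp
  consider (a) "j = 0" | (b) "j > 0" by auto
  then show "int p dvd coeff (euler_deriv (polyexp_mod p j)
      - polyexp_rhs (top_term p) (polyexp_mod p) j) t"
  proof cases
    case a
    show ?thesis
    proof (cases t)
      case 0
      then show ?thesis using a p
        by (simp add: polyexp_rhs_def top_term_def coeff_mult_0)
    next
      case (Suc s)
      have x: "coeff (monom 1 1 * f) (Suc s) = coeff f s" for f :: "int poly"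
        by (simp add: coeff_monom_mult)
      show ?thesis
        using fermat_inverse_mult[OF p nd[of t], of "fact s"] a Suc
        by (cases "t < p")
           (auto simp: polyexp_rhs_def top_term_def x coeff_polyexp_mod mult.commute[of "fact s"] less_Suc_eq
             simp del: One_nat_def)
    qed
  next
    case b
    then obtain i where i: "j = Suc i" by (cases j) auto
    have "coeff (polyexp_rhs (top_term p) (polyexp_mod p) j) t
        = coeff (polyexp_mod p i) t - (if i = 0 \<and> t = 0 then 1 else 0)"
      using i by (cases t) (auto simp: polyexp_rhs_def)
    then show ?thesis
      using fermat_inverse_mult[OF p nd[of t], of "fact t * int t ^ i"] i z p(2)
      by (cases "t = 0") (auto simp: coeff_polyexp_mod power_0_left mult_ac)
  qed
qed

lemma jets_polyexp_mod:
  assumes p: "prime p" "p \<ge> 3" and "k \<ge> 1" "d < p"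
  shows "jets p k d (polyexp_mod p)"
proof
  fix j
  have "int p dvd coeff (euler_deriv (polyexp_mod p j) - polyexp_rhs 0 (polyexp_mod p) j) t" if "t < p" for t
  proof -
    have "coeff (polyexp_rhs 0 (polyexp_mod p) j) t = coeff (polyexp_rhs (top_term p) (polyexp_mod p) j) t"
      using that by (simp add: polyexp_rhs_def top_term_def)
    then show ?thesis
      using polyexp_mod_rhs[OF p, of j] unfolding const_poly_dvd_iff by simp
  qed
  then show "euler_deriv (polyexp_mod p j) - polyexp_rhs 0 (polyexp_mod p) j \<in> jet_ideal p"
    by (simp add: jet_ideal_def)
qed (use assms in \<open>auto simp: coeff_polyexp_mod\<close>)

section \<open>Folding exponents by Fermat's theorem\<close>

text \<open>
  The functions \<open>a \<mapsto> a^t\<close> and \<open>a \<mapsto> a^(t mod p + t div p)\<close> agree on \<open>\<int>/p\<close>. A combination of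
  \<open>x^(a + p b)\<close> with \<open>a\<close> and \<open>b\<close> small has large degree, but on \<open>\<int>/p\<close> it has the few parameters of a
  polynomial of degree \<open>a + b\<close>. This is where the construction gains.
\<close>

definition fold_exp :: "nat \<Rightarrow> nat \<Rightarrow> nat" where
  "fold_exp p t = t mod p + t div p"

lemma power_fold_exp:
  assumes "prime p"
  shows "[a ^ t = a ^ fold_exp p t] (mod int p)"
proof -
  have "[a ^ p = a] (mod int p)"
  proof (cases "int p dvd a")
    case True
    have "int p dvd a ^ p - a"
      by (rule dvd_diff[OF dvd_trans[OF True dvd_power] True]) (use prime_gt_0_nat[OF assms] in auto)
    then show ?thesis by (simp add: cong_iff_dvd_diff)
  next
    case False
    have "a ^ p - a = a * (a ^ (p - 1) - 1)"
      using prime_gt_0_nat[OF assms] by (cases p) (simp_all add: algebra_simps)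
    then show ?thesis using fermat_int[OF assms False] by (simp add: cong_iff_dvd_diff)
  qed
  then have "[(a ^ p) ^ (t div p) * a ^ (t mod p) = a ^ (t div p) * a ^ (t mod p)] (mod int p)"
    by (intro cong_mult cong_pow cong_refl)
  moreover have "(a ^ p) ^ (t div p) * a ^ (t mod p) = a ^ t"
    by (simp flip: power_mult power_add)
  moreover have "a ^ (t div p) * a ^ (t mod p) = a ^ fold_exp p t"
    by (simp add: fold_exp_def power_add mult.commute)
  ultimately show ?thesis by simp
qed

text \<open>
  The coefficient of \<open>x\<^sup>u\<close> after folding. Cutting off at \<open>p\<^sup>2\<close> keeps the index set finite; an exponent
  that folds to less than \<open>p\<close> lies below this bound.
\<close>

definition folded_coeff :: "nat \<Rightarrow> int poly \<Rightarrow> nat \<Rightarrow> int" where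
  "folded_coeff p f u = (\<Sum>t | t < p * p \<and> fold_exp p t = u. coeff f t)"

definition foldable :: "nat \<Rightarrow> nat \<Rightarrow> nat \<Rightarrow> int poly \<Rightarrow> bool" where
  "foldable p a s f \<longleftrightarrow> (\<forall>t. coeff f t \<noteq> 0 \<longrightarrow> t mod p \<le> a \<and> fold_exp p t \<le> s)"

lemma folded_coeff_diff: "folded_coeff p (f - g) u = folded_coeff p f u - folded_coeff p g u"
  by (simp add: folded_coeff_def sum_subtractf)

lemma poly_folded:
  assumes p: "prime p" and f: "foldable p b s f" and s: "s < p"
    and z: "\<And>u. u \<le> s \<Longrightarrow> int p dvd folded_coeff p f u"
  shows "int p dvd poly f a"
proof -
  have sm: "t < p * p" if "fold_exp p t \<le> s" for t
  proof -
    have "t div p < p" using that s by (simp add: fold_exp_def)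
    then show ?thesis using prime_gt_0_nat[OF p] by (simp add: div_less_iff_less_mult)
  qed
  let ?T = "{t. t < p * p \<and> fold_exp p t \<le> s}"
  have fin: "finite ?T" by (rule finite_subset[of _ "{..<p * p}"]) auto
  have zero: "coeff f t = 0" if "t \<notin> ?T" for t
    using that f sm[of t] unfolding foldable_def by blast
  have "(\<Sum>t\<le>degree f. coeff f t * a ^ t) = (\<Sum>t\<in>{..degree f} \<union> ?T. coeff f t * a ^ t)"
  proof (rule sum.mono_neutral_left)
    show "\<forall>t\<in>({..degree f} \<union> ?T) - {..degree f}. coeff f t * a ^ t = 0"
      by (metis (no_types, lifting) DiffD2 atMost_iff coeff_eq_0 mult_zero_left not_le)
  qed (use fin in blast)+
  also have "\<dots> = (\<Sum>t\<in>?T. coeff f t * a ^ t)"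
  proof (rule sum.mono_neutral_right)
    show "\<forall>t\<in>({..degree f} \<union> ?T) - ?T. coeff f t * a ^ t = 0"
      by (metis (no_types, lifting) DiffD2 zero mult_zero_left)
  qed (use fin in blast)+
  finally have "poly f a = (\<Sum>t\<in>?T. coeff f t * a ^ t)" by (simp only: poly_altdef)
  also have "[\<dots> = (\<Sum>t\<in>?T. coeff f t * a ^ fold_exp p t)] (mod int p)"
    by (rule cong_sum) (rule cong_mult[OF cong_refl power_fold_exp[OF p]])
  also have "(\<Sum>t\<in>?T. coeff f t * a ^ fold_exp p t)
      = (\<Sum>u\<le>s. \<Sum>t | t \<in> ?T \<and> fold_exp p t = u. coeff f t * a ^ fold_exp p t)"
    by (rule sum.group[symmetric, OF fin]) auto
  also have "\<dots> = (\<Sum>u\<le>s. folded_coeff p f u * a ^ u)"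
  proof (rule sum.cong[OF refl])
    fix u assume "u \<in> {..s}"
    then have u: "{t \<in> ?T. fold_exp p t = u} = {t. t < p * p \<and> fold_exp p t = u}" by auto
    show "(\<Sum>t | t \<in> ?T \<and> fold_exp p t = u. coeff f t * a ^ fold_exp p t) = folded_coeff p f u * a ^ u"
      unfolding u folded_coeff_def sum_distrib_right by (rule sum.cong) auto
  qed
  finally have "[poly f a = (\<Sum>u\<le>s. folded_coeff p f u * a ^ u)] (mod int p)" .
  then show ?thesis
  proof (rule iffD2[OF cong_dvd_iff])
    show "int p dvd (\<Sum>u\<le>s. folded_coeff p f u * a ^ u)"
      using z by (intro dvd_sum dvd_mult2) auto
  qed
qed

lemma foldable_mono: "foldable p a s f \<Longrightarrow> a \<le> a' \<Longrightarrow> s \<le> s' \<Longrightarrow> foldable p a' s' f"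
  by (force simp: foldable_def)

lemma foldable_0: "foldable p a s 0"
  by (simp add: foldable_def)

lemma foldable_add: "foldable p a s f \<Longrightarrow> foldable p a s g \<Longrightarrow> foldable p a s (f + g)"
  unfolding foldable_def coeff_add by (metis add.right_neutral)

lemma foldable_diff: "foldable p a s f \<Longrightarrow> foldable p a s g \<Longrightarrow> foldable p a s (f - g)"
  unfolding foldable_def coeff_diff by (metis diff_0_right)

lemma foldable_of_nat_mult: "foldable p a s f \<Longrightarrow> foldable p a s (of_nat n * f)"
  by (simp add: foldable_def of_nat_poly)

lemma foldable_euler_deriv: "foldable p a s f \<Longrightarrow> foldable p a s (euler_deriv f)"
  by (simp add: foldable_def)

lemma foldable_sum: "(\<And>i. i \<in> S \<Longrightarrow> foldable p a s (f i)) \<Longrightarrow> foldable p a s (sum f S)"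
  by (induction S rule: infinite_finite_induct) (auto intro: foldable_0 foldable_add)

lemma foldable_monom: "t mod p \<le> a \<Longrightarrow> fold_exp p t \<le> s \<Longrightarrow> foldable p a s (monom c t)"
  by (simp add: foldable_def)

lemma foldable_times_x:
  assumes "foldable p a s f" "a + 1 < p"
  shows "foldable p (a + 1) (s + 1) (monom 1 1 * f)"
  unfolding foldable_def
proof (intro allI impI)
  fix t assume t: "coeff (monom 1 1 * f) t \<noteq> 0"
  then obtain t' where t': "t = Suc t'" "coeff f t' \<noteq> 0"
    by (cases t) (auto simp: coeff_monom_mult)
  then have b: "t' mod p \<le> a" "fold_exp p t' \<le> s" using assms(1) by (auto simp: foldable_def)
  then have "Suc t' mod p = Suc (t' mod p)" "Suc t' div p = t' div p"
    using assms(2) by (auto simp: mod_Suc div_Suc)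
  then show "t mod p \<le> a + 1 \<and> fold_exp p t \<le> s + 1"
    using b t' by (simp add: fold_exp_def)
qed

lemma foldable_times_monom_p:
  assumes "foldable p a s f" "p > 0"
  shows "foldable p a (s + 1) (monom c p * f)"
  unfolding foldable_def
proof (intro allI impI)
  fix t assume t: "coeff (monom c p * f) t \<noteq> 0"
  then have "t \<ge> p" "coeff f (t - p) \<noteq> 0"
    by (auto simp: coeff_monom_mult split: if_splits)
  moreover have "t mod p = (t - p) mod p" "t div p = Suc ((t - p) div p)"
    using \<open>t \<ge> p\<close> assms(2) by (auto simp: le_mod_geq le_div_geq)
  ultimately show "t mod p \<le> a \<and> fold_exp p t \<le> s + 1"
    using assms(1) by (auto simp: foldable_def fold_exp_def)
qed

lemma foldable_form_deriv:
  assumes "\<And>m. foldable p a s (F m)" "a + 1 < p"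
  shows "foldable p (a + 1) (s + 1) (form_deriv k (top_term p) F m)"
proof -
  have le: "foldable p (a + 1) (s + 1) (F m)" for m
    by (rule foldable_mono[OF assms(1)]) auto
  have w: "foldable p (a + 1) (s + 1) (top_term p * F m)" for m
    unfolding top_term_def
    by (rule foldable_mono[OF foldable_times_monom_p[OF assms(1)]]) (use assms(2) in auto)
  show ?thesis
    unfolding form_deriv_def lowering_def
    by (intro foldable_add foldable_diff foldable_sum foldable_of_nat_mult foldable_euler_deriv
          foldable_times_x w le assms)
       (auto intro!: foldable_of_nat_mult foldable_0 le[simplified] simp del: of_nat_add of_nat_Suc fun_upd_apply)
qed

lemma foldable_funpow_form_deriv:
  assumes "\<And>m. foldable p a s (F m)" "a + r < p"
  shows "foldable p (a + r) (s + r) ((form_deriv k (top_term p) ^^ r) F m)"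
  using assms(2)
proof (induction r arbitrary: m)
  case (Suc r)
  then show ?case
    using foldable_form_deriv[of p "a + r" "s + r" "(form_deriv k (top_term p) ^^ r) F"] by simp
qed (use assms in simp)

section \<open>The auxiliary polynomial\<close>

definition box :: "nat \<Rightarrow> nat \<Rightarrow> (nat \<Rightarrow> nat) set" where
  "box k N = {m. (\<forall>j>k. m j = 0) \<and> (\<forall>j\<le>k. m j < N)}"

lemma bij_betw_box: "bij_betw (\<lambda>m. restrict m {..k}) (box k N) ({..k} \<rightarrow>\<^sub>E {..<N})"
  by (rule bij_betw_byWitness[where f' = "\<lambda>f j. if j \<le> k then f j else 0"])
     (auto simp: box_def fun_eq_iff restrict_def PiE_def extensional_def)

lemma card_box: "card (box k N) = N ^ (k + 1)"
  using bij_betw_same_card[OF bij_betw_box[of k N]] by (simp add: card_PiE)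

lemma finite_box: "finite (box k N)"
  using bij_betw_finite[OF bij_betw_box[of k N]] by (simp add: finite_PiE)

lemma box_subset_mons: "box k N \<subseteq> mons k ((k + 1) * N)"
proof
  fix m assume m: "m \<in> box k N"
  have "(\<Sum>j\<le>k. m j) \<le> (\<Sum>j\<le>k. N)"
    by (rule sum_mono) (use m in \<open>auto simp: box_def\<close>)
  then show "m \<in> mons k ((k + 1) * N)" using m by (simp add: box_def mons_def)
qed

text \<open>
  The auxiliary form is \<open>\<Sum>\<^sub>b x^(p b) F\<^sub>b\<close>, where the slice \<open>F\<^sub>b\<close> has coefficients of degree below \<open>A\<close> in
  \<open>x\<close>, and exponents below \<open>N\<close> in each \<open>G\<^sub>j\<close>.
\<close>

definition slice_form :: "nat \<Rightarrow> nat \<Rightarrow> nat \<Rightarrow> (nat \<times> nat \<times> (nat \<Rightarrow> nat) \<Rightarrow> int) \<Rightarrow> nat \<Rightarrow> form" where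
  "slice_form A k N l b m = (if m \<in> box k N then \<Sum>a<A. monom (l (a, b, m)) a else 0)"

definition aux_form ::
  "nat \<Rightarrow> nat \<Rightarrow> nat \<Rightarrow> nat \<Rightarrow> nat \<Rightarrow> (nat \<times> nat \<times> (nat \<Rightarrow> nat) \<Rightarrow> int) \<Rightarrow> form" where
  "aux_form p A B k N l m = (\<Sum>b<B. monom 1 (p * b) * slice_form A k N l b m)"

lemma coeff_slice_form:
  "coeff (slice_form A k N l b m) a = (if m \<in> box k N \<and> a < A then l (a, b, m) else 0)"
  by (simp add: slice_form_def coeff_sum)

lemma is_form_slice: "is_form k ((k + 1) * N) (slice_form A k N l b)"
  using box_subset_mons[of k N] by (auto simp: is_form_def slice_form_def)

lemma is_form_aux: "is_form k ((k + 1) * N) (aux_form p A B k N l)"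
  using is_form_slice[of k N A l] by (simp add: is_form_def aux_form_def)

lemma slice_form_diff:
  "slice_form A k N (\<lambda>i. l i - l' i) b m = slice_form A k N l b m - slice_form A k N l' b m"
  by (simp add: poly_eq_iff coeff_slice_form)

lemma aux_form_diff:
  "aux_form p A B k N (\<lambda>i. l i - l' i) m = aux_form p A B k N l m - aux_form p A B k N l' m"
  by (simp add: aux_form_def slice_form_diff right_diff_distrib sum_subtractf)

lemma foldable_aux_form:
  assumes "A < p"
  shows "foldable p A (A + B) (aux_form p A B k N l m)"
proof -
  have "foldable p A (A + B) (monom c a * monom 1 (p * b))" if "a < A" "b < B" for a b c
    unfolding mult_monom
    by (rule foldable_monom) (use that assms in \<open>auto simp: fold_exp_def\<close>)
  then show ?thesis
    unfolding aux_form_def slice_form_def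
    by (auto simp: sum_distrib_left mult.commute[of "monom 1 _"] sum_distrib_right
        intro!: foldable_sum foldable_0)
qed

lemma degree_aux_form: "degree (aux_form p A B k N l m) \<le> A + p * B"
  unfolding aux_form_def
proof (rule degree_sum_le)
  fix b assume b: "b \<in> {..<B}"
  have "degree (slice_form A k N l b m) \<le> A"
    by (rule degree_le) (simp add: coeff_slice_form)
  moreover have "degree (monom (1 :: int) (p * b)) \<le> p * B"
    using b by (simp add: degree_monom_eq)
  ultimately show "degree (monom 1 (p * b) * slice_form A k N l b m) \<le> A + p * B"
    using degree_mult_le[of "monom 1 (p * b)" "slice_form A k N l b m"] by linarith
qed simp

lemma lowering_diff: "lowering k (\<lambda>m. F m - H m) m = lowering k F m - lowering k H m"
proof -
  have *: "(if c then 0 else n * (f - h)) = (if c then 0 else n * f) - (if c then 0 else n * h)"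
    for c and n f h :: "int poly"
    by (simp add: right_diff_distrib)
  show ?thesis
    unfolding lowering_def * sum_subtractf by (simp add: right_diff_distrib)
qed

lemma form_deriv_diff:
  "form_deriv k w (\<lambda>m. F m - H m) = (\<lambda>m. form_deriv k w F m - form_deriv k w H m)"
  unfolding form_deriv_def lowering_diff euler_deriv_diff right_diff_distrib by (simp add: fun_eq_iff)

lemma funpow_form_deriv_diff:
  "(form_deriv k w ^^ r) (\<lambda>m. F m - H m) = (\<lambda>m. (form_deriv k w ^^ r) F m - (form_deriv k w ^^ r) H m)"
  by (induction r) (simp_all add: form_deriv_diff)

lemma is_form_funpow: "is_form k d F \<Longrightarrow> is_form k d ((form_deriv k w ^^ r) F)"
  by (induction r) (simp_all add: is_form_deriv)

lemma poly_ideal_multiples: "poly_ideal {f. c dvd f}"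
  by (simp add: poly_ideal_def)

lemma funpow_form_eval:
  assumes "k \<ge> 1" "is_form k d F"
    and "\<And>j. j \<le> k \<Longrightarrow> [:c:] dvd euler_deriv (G j) - polyexp_rhs w G j"
  shows "[:c:] dvd (euler_deriv ^^ r) (form_eval k d G F) - form_eval k d G ((form_deriv k w ^^ r) F)"
proof (induction r)
  case (Suc r)
  let ?F = "(form_deriv k w ^^ r) F"
  have "[:c:] dvd euler_deriv (form_eval k d G ?F) - form_eval k d G (form_deriv k w ?F)"
    using form_eval_deriv[OF assms(1) is_form_funpow[OF assms(2)] poly_ideal_multiples] assms(3) by simp
  moreover have "[:c:] dvd euler_deriv ((euler_deriv ^^ r) (form_eval k d G F)) - euler_deriv (form_eval k d G ?F)"
    using euler_deriv_dvd[OF Suc] by (simp only: euler_deriv_diff)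
  ultimately have "[:c:] dvd (euler_deriv ((euler_deriv ^^ r) (form_eval k d G F)) - euler_deriv (form_eval k d G ?F))
      + (euler_deriv (form_eval k d G ?F) - form_eval k d G (form_deriv k w ?F))"
    by (intro dvd_add)
  then show ?case by simp
qed simp

text \<open>
  At a root of \<open>G\<^sub>k\<close> all monomials containing \<open>G\<^sub>k\<close> drop out. So vanishing there costs only conditions on
  forms in one variable less, a saving of a factor of order \<open>N\<close>.
\<close>

lemma form_eval_root:
  assumes "k \<ge> 1" and F: "is_form k d F" and root: "c dvd poly (G k) a"
    and z: "\<And>m. m \<in> box (k - 1) (d + 1) \<Longrightarrow> c dvd poly (F m) a"
  shows "c dvd poly (form_eval k d G F) (a :: int)"
  unfolding form_eval_def poly_sum poly_mult
proof (rule dvd_sum)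
  fix m assume m: "m \<in> mons k d"
  show "c dvd poly (F m) a * poly (mon_eval k G m) a"
  proof (cases "m k = 0")
    case True
    have "m j = 0" if "j > k - 1" for j
      using that m True by (cases "j = k") (auto simp: mons_def)
    then have "m \<in> box (k - 1) (d + 1)"
      using mons_le[OF m] by (auto simp: box_def less_Suc_eq_le)
    then show ?thesis using z by simp
  next
    case False
    have "c dvd poly (G k) a ^ m k"
      using root False by (meson dvd_power dvd_trans gr0I)
    then have "c dvd (\<Prod>j\<le>k. poly (G j) a ^ m j)"
      by (rule dvd_trans[OF _ dvd_prodI]) auto
    then show ?thesis by (simp add: mon_eval_def poly_prod)
  qed
qed

lemma degree_mon_eval:
  assumes "\<And>j. degree (G j) \<le> p" "m \<in> mons k d"
  shows "degree (mon_eval k G m) \<le> p * d"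
proof -
  have "degree (mon_eval k G m) \<le> (\<Sum>j\<le>k. degree (G j ^ m j))"
    unfolding mon_eval_def using degree_prod_sum_le[of "{..k}" "\<lambda>j. G j ^ m j"] by (simp add: o_def)
  also have "\<dots> \<le> (\<Sum>j\<le>k. p * m j)"
    by (rule sum_mono) (meson assms(1) degree_power_le le_trans mult_le_mono1)
  also have "\<dots> = p * (\<Sum>j\<le>k. m j)" by (simp add: sum_distrib_left)
  also have "\<dots> \<le> p * d" using assms(2) by (simp add: mons_def)
  finally show ?thesis .
qed

text \<open>
  Modulo \<open>x\<^bsup>p(b+1)\<^esup>\<close> only the slices up to \<open>b\<close> matter. If the evaluation vanishes modulo \<open>p\<close>, then the
  first nonzero slice vanishes to order \<open>p\<close> at the origin, against the zero estimate.
\<close>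

lemma aux_form_eval_nonzero:
  assumes p: "prime p" "p \<ge> 3" and k: "k \<ge> 1" and d: "d = (k + 1) * N"
    and ze: "(A + 1) * (d + 2) ^ (k * d + 1) \<le> p"
    and l: "a < A" "b < B" "m \<in> box k N" "\<not> int p dvd l (a, b, m)"
  shows "\<not> [:int p:] dvd form_eval k d (polyexp_mod p) (aux_form p A B k N l)"
proof
  let ?ev = "form_eval k d (polyexp_mod p)" and ?sl = "slice_form A k N l"
  assume dvd: "[:int p:] dvd ?ev (aux_form p A B k N l)"
  have ev: "?ev (aux_form p A B k N l) = (\<Sum>b<B. monom 1 (p * b) * ?ev (?sl b))"
    unfolding form_eval_def aux_form_def sum_distrib_left sum_distrib_right
    by (subst sum.swap) (simp only: mult.assoc)
  have "d + 2 \<le> (d + 2) ^ (k * d + 1)" by (rule self_le_power) auto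
  also have "\<dots> \<le> (A + 1) * (d + 2) ^ (k * d + 1)" by simp
  finally have dp: "d < p" using ze by linarith
  interpret jets p k d "polyexp_mod p"
    by (rule jets_polyexp_mod[OF p k dp])
  have "[:int p:] dvd ?sl b m" if "b < B" for b m
    using that
  proof (induction b arbitrary: m rule: less_induct)
    case (less b)
    have "int p dvd coeff (?ev (?sl b)) s" if s: "s < p" for s
    proof -
      have "(\<Sum>b'<B. monom 1 (p * b') * ?ev (?sl b'))
          = monom 1 (p * b) * ?ev (?sl b) + (\<Sum>b'\<in>{..<B}-{b}. monom 1 (p * b') * ?ev (?sl b'))"
        using less.prems by (subst sum.remove[of _ b]) auto
      moreover have "int p dvd coeff (\<Sum>b'\<in>{..<B}-{b}. monom 1 (p * b') * ?ev (?sl b')) (p * b + s)"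
        unfolding coeff_sum
      proof (rule dvd_sum)
        fix b' assume b': "b' \<in> {..<B} - {b}"
        show "int p dvd coeff (monom 1 (p * b') * ?ev (?sl b')) (p * b + s)"
        proof (cases "b' < b")
          case True
          have "[:int p:] dvd ?ev (?sl b')"
            unfolding form_eval_def using less.IH[OF True] b' by (intro dvd_sum dvd_mult2) auto
          then have "[:int p:] dvd monom 1 (p * b') * ?ev (?sl b')" by (rule dvd_mult)
          then show ?thesis unfolding const_poly_dvd_iff by blast
        next
          case False
          then have "Suc b \<le> b'" using b' by auto
          then have "p * Suc b \<le> p * b'" by (rule mult_le_mono2)
          then have "p * b + s < p * b'" using s by simp
          then show ?thesis by (simp add: coeff_monom_mult)
        qed
      qed
      moreover have "int p dvd coeff (?ev (aux_form p A B k N l)) (p * b + s)"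
        using dvd unfolding const_poly_dvd_iff by blast
      ultimately have "int p dvd coeff (monom 1 (p * b) * ?ev (?sl b)) (p * b + s)"
        unfolding ev by (simp add: dvd_add_left_iff)
      then show ?thesis by (simp add: coeff_monom_mult)
    qed
    then have jet: "?ev (?sl b) \<in> jet_ideal p" by (simp add: jet_ideal_def)
    show ?case
    proof (rule zero_estimate[OF _ jet])
      show "is_form k d (?sl b)" unfolding d by (rule is_form_slice)
      show "[:int p:] dvd ?sl b m" if "k * d < mon_weight k m" for m
      proof -
        have "m \<notin> mons k d"
        proof
          assume m: "m \<in> mons k d"
          have "mon_weight k m \<le> (\<Sum>j\<le>k. k * m j)"
            unfolding mon_weight_def by (rule sum_mono) auto
          also have "\<dots> = k * (\<Sum>j\<le>k. m j)" by (simp add: sum_distrib_left)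
          also have "\<dots> \<le> k * d" using m by (simp add: mons_def)
          finally show False using that by simp
        qed
        then show ?thesis using is_form_slice[of k N A l b] unfolding d[symmetric] is_form_def by simp
      qed
      show "int p dvd coeff (?sl b m) t" if "t > A" for m t
        using that by (simp add: coeff_slice_form)
      show "(A + 1) * (d + 2) ^ (k * d + 1) \<le> p" by (rule ze)
    qed
  qed
  then have "int p dvd coeff (?sl b m) a" using l(2) unfolding const_poly_dvd_iff by blast
  then show False using l by (simp add: coeff_slice_form)
qed

text \<open>
  More unknowns than linear conditions over \<open>\<int>/p\<close>: by the pigeonhole principle two coefficient systems
  satisfy the conditions with the same residues, and their difference is a nontrivial solution.
\<close>

lemma aux_coefficients_exist:
  assumes p: "prime p"
    and cnt: "M * (d + 1) ^ k * (S + 1) < A * B * N ^ (k + 1)" and k: "k \<ge> 1"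
  shows "\<exists>l. (\<exists>a b m. a < A \<and> b < B \<and> m \<in> box k N \<and> \<not> int p dvd l (a, b, m)) \<and>
     (\<forall>r<M. \<forall>m\<in>box (k - 1) (d + 1). \<forall>u\<le>S.
        int p dvd folded_coeff p ((form_deriv k w ^^ r) (aux_form p A B k N l) m) u)"
proof -
  let ?Ix = "{..<A} \<times> {..<B} \<times> box k N" and ?J = "{..<M} \<times> box (k - 1) (d + 1) \<times> {..S}"
  let ?R = "{0..<int p}"
  define \<kappa> where "\<kappa> l = restrict (\<lambda>(r, m, u).
      folded_coeff p ((form_deriv k w ^^ r) (aux_form p A B k N l) m) u mod int p) ?J" for l
  have pos: "p > 1" using prime_gt_1_nat[OF p] .
  have fin: "finite ?Ix" "finite ?J" by (auto simp: finite_box)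
  have "card (box (k - 1) (d + 1)) = (d + 1) ^ k"
    using card_box[of "k - 1" "d + 1"] k by simp
  then have "card ?J = M * ((d + 1) ^ k * (S + 1))"
    by (simp only: card_cartesian_product card_lessThan card_atMost Suc_eq_plus1)
  moreover have "card ?Ix = A * (B * N ^ (k + 1))"
    by (simp only: card_cartesian_product card_lessThan card_box)
  ultimately have "card ?J < card ?Ix"
    using cnt by (simp only: mult.assoc)
  then have "card (?J \<rightarrow>\<^sub>E ?R) < card (?Ix \<rightarrow>\<^sub>E ?R)"
    using pos fin by (simp add: card_PiE)
  moreover have "\<kappa> ` (?Ix \<rightarrow>\<^sub>E ?R) \<subseteq> ?J \<rightarrow>\<^sub>E ?R"
    using pos unfolding \<kappa>_def by (auto simp del: mem_Times_iff)
  then have "card (\<kappa> ` (?Ix \<rightarrow>\<^sub>E ?R)) \<le> card (?J \<rightarrow>\<^sub>E ?R)"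
    by (intro card_mono finite_PiE fin) auto
  ultimately have "\<not> inj_on \<kappa> (?Ix \<rightarrow>\<^sub>E ?R)"
    by (intro pigeonhole) linarith
  then obtain l1 l2 where l: "l1 \<in> ?Ix \<rightarrow>\<^sub>E ?R" "l2 \<in> ?Ix \<rightarrow>\<^sub>E ?R" "\<kappa> l1 = \<kappa> l2" "l1 \<noteq> l2"
    by (auto simp: inj_on_def)
  let ?l = "\<lambda>i. l1 i - l2 i"
  obtain i where i: "l1 i \<noteq> l2 i" using l(4) by (meson ext)
  have iI: "i \<in> ?Ix"
  proof (rule ccontr)
    assume "i \<notin> ?Ix"
    then have "l1 i = undefined" "l2 i = undefined"
      by (rule PiE_arb[OF l(1)], rule PiE_arb[OF l(2)])
    then show False using i by simp
  qed
  then have "l1 i \<in> ?R" "l2 i \<in> ?R"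
    by (rule PiE_mem[OF l(1)], rule PiE_mem[OF l(2)])
  then have "\<bar>?l i\<bar> < int p" by auto
  then have "\<not> int p dvd ?l i" using i dvd_imp_le_int[of "?l i" "int p"] by auto
  then have 1: "\<exists>a b m. a < A \<and> b < B \<and> m \<in> box k N \<and> \<not> int p dvd ?l (a, b, m)"
    using iI by (cases i) auto
  have 2: "int p dvd folded_coeff p ((form_deriv k w ^^ r) (aux_form p A B k N ?l) m) u"
    if "r < M" "m \<in> box (k - 1) (d + 1)" "u \<le> S" for r m u
  proof -
    let ?f = "\<lambda>l. folded_coeff p ((form_deriv k w ^^ r) (aux_form p A B k N l) m) u"
    have "(r, m, u) \<in> ?J" using that by simp
    then have \<kappa>: "\<kappa> l (r, m, u) = ?f l mod int p" for l
      by (simp only: \<kappa>_def restrict_apply' prod.case)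
    have "?f l1 mod int p = ?f l2 mod int p" using \<kappa>[of l1] \<kappa>[of l2] l(3) by simp
    then have "int p dvd ?f l1 - ?f l2" by (simp only: mod_eq_dvd_iff)
    moreover have "aux_form p A B k N ?l = (\<lambda>m. aux_form p A B k N l1 m - aux_form p A B k N l2 m)"
      by (rule ext) (rule aux_form_diff)
    ultimately show ?thesis by (simp only: funpow_form_deriv_diff folded_coeff_diff)
  qed
  show ?thesis using 1 2 by (intro exI[of _ ?l] conjI) auto
qed

text \<open>
  The auxiliary polynomial vanishes to order \<open>M\<close> at every nonzero root of \<open>G\<^sub>k\<close>; comparing with its
  degree bounds the number of roots. The three conditions on the parameters ensure that it exists,
  that its derivatives fold without wrapping around, and that it is nonzero.
\<close>

theorem stepanov_inequality:
  assumes p: "prime p" "p \<ge> 3" and k: "k \<ge> 1" and d: "d = (k + 1) * N"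
    and cnt: "M * (d + 1) ^ k * (A + B + M + 1) < A * B * N ^ (k + 1)"
    and small: "A + B + M < p"
    and ze: "(A + 1) * (d + 2) ^ (k * d + 1) \<le> p"
  shows "M * card {a \<in> {1..<int p}. int p dvd poly (polyexp_mod p k) a} \<le> A + p * B + p * d"
proof -
  let ?w = "top_term p" and ?ev = "form_eval k d (polyexp_mod p)"
  let ?D = "\<lambda>r. form_deriv k ?w ^^ r"
  obtain l a b m where ne: "a < A" "b < B" "m \<in> box k N" "\<not> int p dvd l (a, b, m)"
    and van: "\<And>r m u. r < M \<Longrightarrow> m \<in> box (k - 1) (d + 1) \<Longrightarrow> u \<le> A + B + M \<Longrightarrow>
      int p dvd folded_coeff p (?D r (aux_form p A B k N l) m) u"
    using aux_coefficients_exist[OF p(1) cnt k, of ?w] by blast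
  let ?F = "aux_form p A B k N l"
  have F: "is_form k d ?F" unfolding d by (rule is_form_aux)
  have "M * card {a \<in> {1..<int p}. int p dvd poly (polyexp_mod p k) a} \<le> degree (?ev ?F)"
  proof (rule multiple_roots_mod_bound[OF p(1)])
    show "\<not> [:int p:] dvd ?ev ?F" by (rule aux_form_eval_nonzero[where l = l, OF p k d ze ne])
    fix a r assume a: "a \<in> {a \<in> {1..<int p}. int p dvd poly (polyexp_mod p k) a}" and r: "r < M"
    have "int p dvd poly (?ev (?D r ?F)) a"
    proof (rule form_eval_root[OF k is_form_funpow[OF F]])
      show "int p dvd poly (polyexp_mod p k) a" using a by simp
      fix m assume m: "m \<in> box (k - 1) (d + 1)"
      have "foldable p (A + r) (A + B + r) (?D r ?F m)"
        by (rule foldable_funpow_form_deriv[OF foldable_aux_form]) (use small r in auto)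
      then have "foldable p (A + r) (A + B + M) (?D r ?F m)"
        by (rule foldable_mono) (use r in auto)
      then show "int p dvd poly (?D r ?F m) a"
        using poly_folded[OF p(1) _ small] van[OF r m] by blast
    qed
    moreover have "int p dvd poly ((euler_deriv ^^ r) (?ev ?F) - ?ev (?D r ?F)) a"
      by (rule poly_dvd_const, rule funpow_form_eval[OF k F]) (rule polyexp_mod_rhs[OF p])
    ultimately have "int p dvd (poly ((euler_deriv ^^ r) (?ev ?F)) a - poly (?ev (?D r ?F)) a) + poly (?ev (?D r ?F)) a"
      by (intro dvd_add) simp_all
    then show "int p dvd poly ((euler_deriv ^^ r) (?ev ?F)) a" by simp
  qed (use small in auto)
  also have "degree (?ev ?F) \<le> A + p * B + p * d"
    unfolding form_eval_def
  proof (rule degree_sum_le)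
    fix m assume m: "m \<in> mons k d"
    have "degree (mon_eval k (polyexp_mod p) m) \<le> p * d"
      by (rule degree_mon_eval[OF _ m]) (use degree_polyexp_mod[of p] p in \<open>auto intro: less_imp_le\<close>)
    then show "degree (?F m * mon_eval k (polyexp_mod p) m) \<le> A + p * B + p * d"
      using degree_mult_le[of "?F m" "mon_eval k (polyexp_mod p) m"] degree_aux_form[of p A B k N l m] by linarith
  qed simp
  finally show ?thesis .
qed

section \<open>From rational to modular roots\<close>

text \<open>
  Multiplication by \<open>Q = \<Prod> i! i\<^sup>k\<close> clears all denominators, and \<open>Q\<close> is a unit modulo \<open>p\<close>.
\<close>

lemma modular_root_of_rational_root:
  assumes p: "prime p" "p \<ge> 3" and k: "k \<ge> 1"
    and root: "rat_cong p (poly (truncated_polyexp p k) (of_nat x)) 0"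
  shows "int p dvd poly (polyexp_mod p k) (int x)"
proof -
  define q where "q i = fact i * int i ^ k" for i
  define Q where "Q = (\<Prod>i=1..p-1. q i)"
  define c where "c i = (\<Prod>j\<in>{1..p-1}-{i}. q j)" for i
  have cq: "q i * c i = Q" if "i \<in> {1..p-1}" for i
    unfolding Q_def c_def using that by (subst prod.remove[of _ i]) auto
  have nq: "\<not> int p dvd q i" if i: "i \<in> {1..p-1}" for i
  proof -
    have "i < p" using i p(2) by auto
    then have "\<not> p dvd fact i" using p(1) by (simp add: prime_dvd_fact_iff)
    then have "\<not> int p dvd fact i" by (metis int_dvd_int_iff of_nat_fact)
    moreover have "\<not> p dvd i" using i \<open>i < p\<close> by (auto dest: dvd_imp_le)
    then have "\<not> int p dvd int i ^ k"
      using p(1) by (meson int_dvd_int_iff prime_dvd_power prime_nat_int_transfer)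
    ultimately show ?thesis using p(1) by (simp add: q_def prime_dvd_mult_iff)
  qed
  have nQ: "\<not> int p dvd Q"
    unfolding Q_def using p(1) nq by (subst prime_dvd_prod_iff) auto
  define E where "E = (\<Sum>i=1..p-1. c i * int x ^ i)"
  have E: "of_int Q * poly (truncated_polyexp p k) (of_nat x) = (of_int E :: rat)"
  proof -
    have "of_int Q * (1 / (fact i * of_nat i ^ k) * of_nat x ^ i) = (of_int (c i * int x ^ i) :: rat)"
      if i: "i \<in> {1..p-1}" for i
    proof -
      have "(of_int (q i) :: rat) = fact i * of_nat i ^ k" by (simp add: q_def)
      moreover have "q i \<noteq> 0" using nq[OF i] by auto
      ultimately show ?thesis
        using i unfolding cq[OF i, symmetric] by (simp add: field_simps)
    qed
    then show ?thesis
      by (simp add: truncated_polyexp_def poly_sum poly_monom sum_distrib_left E_def)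
  qed
  have pE: "int p dvd E"
  proof -
    obtain u v where uv: "coprime v (int p)"
      "poly (truncated_polyexp p k) (of_nat x) = (of_nat p * (of_int u / of_int v) :: rat)"
      using root unfolding rat_cong_def by auto
    have "v \<noteq> 0" using uv(1) prime_gt_1_nat[OF p(1)] by auto
    then have "(of_int (E * v) :: rat) = of_int (int p * (u * Q))"
      using E[symmetric] uv(2) by (simp add: field_simps)
    then have "E * v = int p * (u * Q)" by (simp only: of_int_eq_iff)
    then have "int p dvd E * v" by simp
    then show ?thesis using uv(1) by (metis coprime_commute coprime_dvd_mult_left_iff)
  qed
  have z: "(0 :: int) ^ (p - 2) = 0" using p(2) by simp
  have "poly (polyexp_mod p k) (int x) = (\<Sum>i<p. q i ^ (p - 2) * int x ^ i)"
    by (simp add: polyexp_mod_def poly_sum poly_monom q_def)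
  also have "\<dots> = (\<Sum>i=1..p-1. q i ^ (p - 2) * int x ^ i)"
    by (rule sum.mono_neutral_right)
       (use p(2) k z in \<open>auto simp: q_def power_0_left not_le Suc_le_eq\<close>)
  finally have "Q * poly (polyexp_mod p k) (int x) - E
      = (\<Sum>i=1..p-1. c i * int x ^ i * (q i * q i ^ (p - 2) - 1))"
    unfolding E_def by (simp add: sum_distrib_left cq[symmetric] algebra_simps flip: sum_subtractf)
  also have "int p dvd \<dots>"
    using fermat_inverse[OF p nq] by (intro dvd_sum dvd_mult) auto
  finally have "int p dvd Q * poly (polyexp_mod p k) (int x) - E + E"
    using pE by (rule dvd_add)
  then show ?thesis using nQ p(1) by (simp add: prime_dvd_mult_iff)
qed

text \<open>
  The additional solution is \<open>x = 0\<close>, a root of every \<open>E\<^sub>k\<close>.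
\<close>

lemma num_solutions_mod_le:
  assumes p: "prime p" "p \<ge> 3" and k: "k \<ge> 1"
  shows "num_solutions_mod p (truncated_polyexp p k)
     \<le> card {a \<in> {1..<int p}. int p dvd poly (polyexp_mod p k) a} + 1"
proof -
  let ?S = "{a \<in> {1..<int p}. int p dvd poly (polyexp_mod p k) a}"
  have fin: "finite ?S" by (rule finite_subset[of _ "{1..<int p}"]) auto
  have "{x. x < p \<and> rat_cong p (poly (truncated_polyexp p k) (of_nat x)) 0} \<subseteq> insert 0 (nat ` ?S)"
  proof
    fix x assume x: "x \<in> {x. x < p \<and> rat_cong p (poly (truncated_polyexp p k) (of_nat x)) 0}"
    then have "int p dvd poly (polyexp_mod p k) (int x)"
      using modular_root_of_rational_root[OF p k] by blast
    then have "x = 0 \<or> int x \<in> ?S" using x by auto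
    then show "x \<in> insert 0 (nat ` ?S)" by (metis (no_types, lifting) image_eqI insert_iff nat_int)
  qed
  then have "num_solutions_mod p (truncated_polyexp p k) \<le> card (insert 0 (nat ` ?S))"
    unfolding num_solutions_mod_def using fin by (intro card_mono) auto
  also have "\<dots> \<le> Suc (card (nat ` ?S))" by (rule card_insert_le_m1) simp_all
  also have "\<dots> \<le> card ?S + 1" using card_image_le[OF fin, of nat] by simp
  finally show ?thesis .
qed

section \<open>Choice of parameters and the final bound\<close>

lemma power_growth_le_exp_square:
  fixes K L R :: real
  assumes "K > 0" "L > 0" "R > 0"
  shows "eventually (\<lambda>x. ((K * x) ^ 2 + 1) * (L * x + 2) powr (R * x + 1) \<le> exp (x ^ 2)) at_top"
  using assms by real_asymp

text \<open>
  The parameters are \<open>A = N\<^sup>2\<close>, \<open>B = N\<close> and \<open>M = n N\<close>. Then there are \<open>N^(k+4)\<close> unknowns and at most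
  \<open>3 (k + 2)\<^sup>k n N^(k+3)\<close> conditions, which dictates \<open>N = 6 (k + 2)\<^sup>k n\<close>. The degree is of order \<open>k p N\<close>,
  and dividing it by \<open>M\<close> leaves \<open>k p / n\<close>.
\<close>

lemma root_count_le:
  fixes n :: nat
  assumes p: "prime p" "p \<ge> 3" and k: "k \<ge> 1" and n: "n \<ge> 1"
    and N: "N = 6 * (k + 2) ^ k * n"
    and ze: "(N ^ 2 + 1) * ((k + 1) * N + 2) ^ (k * ((k + 1) * N) + 1) \<le> p"
  shows "n * card {a \<in> {1..<int p}. int p dvd poly (polyexp_mod p k) a} \<le> (k + 3) * p"
proof -
  define c where "c = (k + 2) ^ k"
  define d where "d = (k + 1) * N"
  let ?K = "card {a \<in> {1..<int p}. int p dvd poly (polyexp_mod p k) a}"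
  have c: "c \<ge> 1" by (simp add: c_def)
  have Nc: "N = 6 * (c * n)" using N by (simp add: c_def)
  have "1 * 1 \<le> c * n" by (rule mult_le_mono[OF c n])
  then have N6: "N \<ge> 6" using Nc by simp
  have nN: "n \<le> N" using mult_le_mono1[OF c, of n] Nc by simp
  have sq: "N * 6 \<le> N ^ 2" using N6 by (simp add: power2_eq_square)
  have nN2: "n * N \<le> N ^ 2" using nN by (simp add: power2_eq_square)
  have S: "N ^ 2 + N + n * N + 1 \<le> 3 * N ^ 2" using sq nN2 N6 by linarith
  have Np: "3 * N ^ 2 < p"
  proof -
    have "3 * N ^ 2 < (N ^ 2 + 1) * 3" by simp
    also have "\<dots> \<le> (N ^ 2 + 1) * (d + 2)"
      using N6 by (intro mult_le_mono2) (simp add: d_def)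
    also have "d + 2 \<le> (d + 2) ^ (k * d + 1)" by (rule self_le_power) auto
    then have "(N ^ 2 + 1) * (d + 2) \<le> (N ^ 2 + 1) * (d + 2) ^ (k * d + 1)" by (rule mult_le_mono2)
    also note ze[folded d_def]
    finally show ?thesis .
  qed
  have cnt: "n * N * (d + 1) ^ k * (N ^ 2 + N + n * N + 1) < N ^ 2 * N * N ^ (k + 1)"
  proof -
    have "d + 1 \<le> (k + 2) * N" using N6 by (simp add: d_def)
    then have "(d + 1) ^ k \<le> c * N ^ k"
      using power_mono[of "d + 1" "(k + 2) * N" k] by (simp only: c_def power_mult_distrib)
    then have "n * N * (d + 1) ^ k * (N ^ 2 + N + n * N + 1) \<le> n * N * (c * N ^ k) * (3 * N ^ 2)"
      using S by (intro mult_le_mono) auto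
    also have "\<dots> = 3 * (c * n) * N ^ (k + 3)" by (simp add: power_add algebra_simps eval_nat_numeral)
    also have "\<dots> < N * N ^ (k + 3)" using N6 Nc by simp
    also have "\<dots> = N ^ 2 * N * N ^ (k + 1)" by (simp add: power_add algebra_simps eval_nat_numeral)
    finally show ?thesis .
  qed
  have "n * N * ?K \<le> N ^ 2 + p * N + p * d"
    by (rule stepanov_inequality[OF p k d_def cnt]) (use S Np ze in \<open>auto simp: d_def\<close>)
  also have "\<dots> \<le> p * N + p * N + p * d"
  proof -
    have "N \<le> p" using sq Np by linarith
    then show ?thesis by (simp add: power2_eq_square)
  qed
  also have "\<dots> = N * ((k + 3) * p)" by (simp add: d_def algebra_simps)
  finally have "N * (n * ?K) \<le> N * ((k + 3) * p)" by (simp add: mult_ac)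
  then show ?thesis using N6 by simp
qed

text \<open>
  The height condition of the zero estimate is of size \<open>exp (O(n log n))\<close> for fixed \<open>k\<close>, hence met with
  \<open>n\<^sup>2\<close> of the order of \<open>ln p\<close>.
\<close>

lemma zero_estimate_condition_eventually:
  fixes a b e :: nat
  assumes "a > 0" "b > 0" "e > 0"
  shows "\<exists>n0. \<forall>n\<ge>n0. real (((a * n) ^ 2 + 1) * (b * n + 2) ^ (e * n + 1)) \<le> exp (real n ^ 2)"
proof -
  have "eventually (\<lambda>x. ((real a * x) ^ 2 + 1) * (real b * x + 2) powr (real e * x + 1) \<le> exp (x ^ 2)) at_top"
    using power_growth_le_exp_square assms by simp
  then have "eventually (\<lambda>n. ((real a * real n) ^ 2 + 1) * (real b * real n + 2) powr (real e * real n + 1)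
      \<le> exp (real n ^ 2)) sequentially"
    by (rule eventually_compose_filterlim[OF _ filterlim_real_sequentially])
  moreover have "real (((a * n) ^ 2 + 1) * (b * n + 2) ^ (e * n + 1))
      = ((real a * real n) ^ 2 + 1) * (real b * real n + 2) powr (real e * real n + 1)" for n
  proof -
    have "(real b * real n + 2) powr real (e * n + 1) = (real b * real n + 2) ^ (e * n + 1)"
      by (rule powr_realpow) (simp add: add_nonneg_pos)
    then show ?thesis by (simp add: algebra_simps)
  qed
  ultimately show ?thesis unfolding eventually_sequentially by metis
qed

text \<open>
  For \<open>n = \<lfloor>sqrt (ln p)\<rfloor> \<ge> n\<^sub>0\<close> the root count gives \<open>O(p / n)\<close>. For the remaining primes \<open>sqrt (ln p)\<close> is
  bounded, and the trivial bound \<open>p\<close> suffices.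
\<close>

theorem theorem2:
  fixes k :: nat
  assumes "k \<ge> 1"
  shows "\<exists>C :: real. C > 0 \<and>
    (\<forall>p :: nat. prime p \<and> p \<ge> 3 \<longrightarrow>
       real (num_solutions_mod p (truncated_polyexp p k)) \<le> C * (real p / sqrt (ln (real p))))"
proof -
  define a where "a = 6 * (k + 2) ^ k"
  have "a > 0" "(k + 1) * a > 0" "k * ((k + 1) * a) > 0"
    using assms by (simp_all add: a_def)
  then obtain n0 where n0: "\<And>n. n \<ge> n0 \<Longrightarrow>
      real (((a * n) ^ 2 + 1) * ((k + 1) * a * n + 2) ^ (k * ((k + 1) * a) * n + 1)) \<le> exp (real n ^ 2)"
    using zero_estimate_condition_eventually by blast
  let ?C = "2 * (real k + 3) + 1 + (real n0 + 2)"
  have "real (num_solutions_mod p (truncated_polyexp p k)) \<le> ?C * (real p / sqrt (ln (real p)))"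
    if p: "prime p" "p \<ge> 3" for p
  proof -
    let ?s = "sqrt (ln (real p))" and ?Z = "num_solutions_mod p (truncated_polyexp p k)"
    \<comment> \<open>The largest \<open>n\<close> with \<open>exp (n\<^sup>2) \<le> p\<close>.\<close>
    define n where "n = nat \<lfloor>?s\<rfloor>"
    have ln1: "1 \<le> ln (real p)"
    proof -
      have "exp 1 \<le> real p" using exp_le p(2) by linarith
      then show ?thesis using p(2) by (simp add: ln_ge_iff)
    qed
    then have s1: "1 \<le> ?s" by simp
    have ns: "real n \<le> ?s" "?s < real n + 1"
      using s1 unfolding n_def by linarith+
    have n1: "n \<ge> 1" using s1 unfolding n_def by linarith
    have sq: "real n ^ 2 \<le> ln (real p)"
      using power_mono[OF ns(1), of 2] ln1 by simp
    have sp: "?s \<le> real p"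
    proof -
      have "?s \<le> ?s ^ 2" using s1 by (rule self_le_power) simp
      also have "\<dots> = ln (real p)" using ln1 by simp
      also have "\<dots> \<le> real p" using p(2) ln_bound[of "real p"] by simp
      finally show ?thesis .
    qed
    show ?thesis
    proof (cases "n \<ge> n0")
      case True
      let ?K = "card {b \<in> {1..<int p}. int p dvd poly (polyexp_mod p k) b}"
      have "real (((a * n) ^ 2 + 1) * ((k + 1) * a * n + 2) ^ (k * ((k + 1) * a) * n + 1)) \<le> real p"
      proof -
        have "exp (real n ^ 2) \<le> exp (ln (real p))" using sq by (simp only: exp_le_cancel_iff)
        also have "\<dots> = real p" using p(2) by simp
        finally show ?thesis using n0[OF True] by linarith
      qed
      then have "((a * n) ^ 2 + 1) * ((k + 1) * a * n + 2) ^ (k * ((k + 1) * a) * n + 1) \<le> p"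
        by (simp only: of_nat_le_iff)
      then have "n * ?K \<le> (k + 3) * p"
        by (intro root_count_le[OF p assms n1 refl]) (simp only: a_def mult.assoc)
      then have "real (n * ?K) \<le> real ((k + 3) * p)" by (simp only: of_nat_le_iff)
      then have nK: "real n * real ?K \<le> (real k + 3) * real p"
        by (simp only: of_nat_mult of_nat_add of_nat_numeral)
      have "?s \<le> 2 * real n" using ns(2) n1 by linarith
      then have "?s * real ?K \<le> 2 * real n * real ?K" by (rule mult_right_mono) simp
      also have "\<dots> \<le> 2 * ((real k + 3) * real p)" using nK by linarith
      finally have sK: "?s * real ?K \<le> 2 * ((real k + 3) * real p)" .
      have "real ?Z \<le> real ?K + 1" using num_solutions_mod_le[OF p assms] by linarith
      then have "?s * real ?Z \<le> ?s * (real ?K + 1)" using s1 by (intro mult_left_mono) linarith+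
      also have "\<dots> = ?s * real ?K + ?s" by (simp only: distrib_left mult_1_right)
      also have "\<dots> \<le> 2 * ((real k + 3) * real p) + real p" using sK sp by linarith
      also have "\<dots> = (2 * (real k + 3) + 1) * real p" by (simp only: distrib_right mult_1_left mult.assoc)
      also have "\<dots> \<le> ?C * real p" by (intro mult_right_mono) auto
      finally show ?thesis using s1 by (simp add: field_simps)
    next
      case False
      have "?Z \<le> p"
      proof -
        have "?Z \<le> card {..<p}"
          unfolding num_solutions_mod_def by (rule card_mono) auto
        then show ?thesis by simp
      qed
      moreover have "?s \<le> real n0 + 2" using ns(2) False by linarith
      ultimately have "?s * real ?Z \<le> (real n0 + 2) * real p"
        by (intro mult_mono) auto
      also have "\<dots> \<le> ?C * real p" by (intro mult_right_mono) auto
      finally show ?thesis using s1 by (simp add: field_simps)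
    qed
  qed
  then show ?thesis by (intro exI[of _ ?C]) auto
qed

end
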